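(* Let $C$ be a conjugation on a separable complex Hilbert space $\mathcal{H}$, and let $T$ be a compact $C$-normal operator on $\mathcal{H}$ with Cartesian decomposition $T=A+iB$ (with respect to $C$). Then $$\frac{1}{\sqrt2}\,s_j(|A|+|B|)\le s_j(T)\le s_j(|A|+|B|)\qquad\text{for } j=1,2,\dots.$$
   Context: A conjugation on $\mathcal{H}$ is an anti-linear map $C:\mathcal{H}\to\mathcal{H}$ with $C^2=I$ and $\langle Cx,Cy\rangle=\langle y,x\rangle$ for all $x,y$. A bounded linear operator $T$ is $C$-normal if $C|T|C=|T^*|$ (equivalently $CT^*TC=TT^*$), where $|X|=(X^*X)^{1/2}$. The Cartesian decomposition of $T$ with respect to $C$ is $T=A+iB$ with $A=\frac{T+CT^*C}{2}$ (which is $C$-symmetric: $CAC=A^*$) and $B=\frac{T-CT^*C}{2i}$ (which is $C$-skew-symmetric: $CB^*C=-B$). For a compact operator $X$, the singular values $s_1(X)\ge s_2(X)\ge\cdots$ are the eigenvalues of $|X|$ in decreasing order, repeated according to multiplicity. *)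

theory Defs
  imports "HOL-Analysis.Analysis"
begin

text \<open>
  A complex inner product space is a real one (for \<^term>\<open>Re\<close> of the complex inner product) together
  with a compatible complex scalar multiplication and complex inner product.  Norm, metric and
  topology are those of the underlying real inner product space, so that
  \<open>norm x = sqrt (Re (cinner x x))\<close>.  The inner product is linear in its first argument.
\<close>

class complex_inner = real_inner +
  fixes scaleC :: "complex \<Rightarrow> 'a \<Rightarrow> 'a"  (infixr \<open>*\<^sub>C\<close> 75)
    and cinner :: "'a \<Rightarrow> 'a \<Rightarrow> complex"
  assumes scaleC_add_right: "a *\<^sub>C (x + y) = a *\<^sub>C x + a *\<^sub>C y"
    and scaleC_add_left: "(a + b) *\<^sub>C x = a *\<^sub>C x + b *\<^sub>C x"
    and scaleC_scaleC: "a *\<^sub>C b *\<^sub>C x = (a * b) *\<^sub>C x"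
    and scaleC_one: "1 *\<^sub>C x = x"
    and scaleC_of_real: "complex_of_real r *\<^sub>C x = r *\<^sub>R x"
    and cinner_commute: "cinner x y = cnj (cinner y x)"
    and cinner_add_left: "cinner (x + y) z = cinner x z + cinner y z"
    and cinner_scaleC_left: "cinner (a *\<^sub>C x) y = a * cinner x y"
    and Re_cinner: "Re (cinner x y) = inner x y"

class complex_hilbert = complex_inner + complete_space

instantiation complex :: complex_hilbert
begin
definition scaleC_complex :: "complex \<Rightarrow> complex \<Rightarrow> complex" where "scaleC_complex a x = a * x"
definition cinner_complex :: "complex \<Rightarrow> complex \<Rightarrow> complex" where "cinner_complex x y = x * cnj y"
instance
  by standard
    (auto simp: scaleC_complex_def cinner_complex_def inner_complex_def scaleR_conv_of_real
      algebra_simps)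
end

global_interpretation complex_vector: vector_space "scaleC :: complex \<Rightarrow> 'a \<Rightarrow> 'a::complex_inner"
  by unfold_locales
    (rule scaleC_add_right scaleC_add_left scaleC_scaleC scaleC_one)+

definition bounded_clinear :: "('a::complex_inner \<Rightarrow> 'b::complex_inner) \<Rightarrow> bool" where
  "bounded_clinear T \<longleftrightarrow> bounded_linear T \<and> (\<forall>c x. T (c *\<^sub>C x) = c *\<^sub>C T x)"

definition compact_op :: "('a::complex_inner \<Rightarrow> 'b::complex_inner) \<Rightarrow> bool" where
  "compact_op T \<longleftrightarrow> bounded_clinear T \<and> compact (closure (T ` cball 0 1))"

text \<open>The adjoint exists, and is unique, for every bounded operator on a Hilbert space.\<close>

definition cadjoint :: "('a::complex_hilbert \<Rightarrow> 'a) \<Rightarrow> 'a \<Rightarrow> 'a" where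
  "cadjoint T = (THE S. \<forall>x y. cinner (T x) y = cinner x (S y))"

definition positive_op :: "('a::complex_hilbert \<Rightarrow> 'a) \<Rightarrow> bool" where
  "positive_op P \<longleftrightarrow> bounded_clinear P \<and> (\<forall>x. cinner (P x) x \<in> \<real>\<^sub>\<ge>\<^sub>0)"

text \<open>The unique positive square root of a positive operator.\<close>

definition sqrt_op :: "('a::complex_hilbert \<Rightarrow> 'a) \<Rightarrow> 'a \<Rightarrow> 'a" where
  "sqrt_op P = (THE S. positive_op S \<and> S \<circ> S = P)"

definition abs_op :: "('a::complex_hilbert \<Rightarrow> 'a) \<Rightarrow> 'a \<Rightarrow> 'a" where
  "abs_op T = sqrt_op (cadjoint T \<circ> T)"

definition antilinear :: "('a::complex_inner \<Rightarrow> 'b::complex_inner) \<Rightarrow> bool" where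
  "antilinear C \<longleftrightarrow> (\<forall>x y. C (x + y) = C x + C y) \<and> (\<forall>c x. C (c *\<^sub>C x) = cnj c *\<^sub>C C x)"

definition conjugation :: "('a::complex_hilbert \<Rightarrow> 'a) \<Rightarrow> bool" where
  "conjugation C \<longleftrightarrow>
    antilinear C \<and> C \<circ> C = id \<and> (\<forall>x y. cinner (C x) (C y) = cinner y x)"

definition C_normal :: "('a::complex_hilbert \<Rightarrow> 'a) \<Rightarrow> ('a \<Rightarrow> 'a) \<Rightarrow> bool" where
  "C_normal C T \<longleftrightarrow> bounded_clinear T \<and> C \<circ> abs_op T \<circ> C = abs_op (cadjoint T)"

text \<open>The operators \<open>A\<close> and \<open>B\<close> of the Cartesian decomposition \<open>T = A + \<i>B\<close> with respect to \<open>C\<close>.\<close>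

definition cartesian_A :: "('a::complex_hilbert \<Rightarrow> 'a) \<Rightarrow> ('a \<Rightarrow> 'a) \<Rightarrow> 'a \<Rightarrow> 'a" where
  "cartesian_A C T = (\<lambda>x. (1 / 2) *\<^sub>C (T x + C (cadjoint T (C x))))"

definition cartesian_B :: "('a::complex_hilbert \<Rightarrow> 'a) \<Rightarrow> ('a \<Rightarrow> 'a) \<Rightarrow> 'a \<Rightarrow> 'a" where
  "cartesian_B C T = (\<lambda>x. (1 / (2 * \<i>)) *\<^sub>C (T x - C (cadjoint T (C x))))"

definition eigenspace :: "('a::complex_inner \<Rightarrow> 'a) \<Rightarrow> complex \<Rightarrow> 'a set" where
  "eigenspace P \<mu> = {x. P x = \<mu> *\<^sub>C x}"

text \<open>
  \<open>s 0 \<ge> s 1 \<ge> \<dots> \<ge> 0\<close> lists the eigenvalues of \<open>|X|\<close>: every \<open>\<mu> > 0\<close> occurs exactly as often as its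
  multiplicity (possibly \<open>0\<close>).  If \<open>|X|\<close> has only finitely many positive eigenvalues, the remaining
  entries are therefore \<open>0\<close>, also beyond the dimension of a finite-dimensional space.  The
  finiteness condition is needed because \<^term>\<open>card\<close> is \<open>0\<close> on infinite sets.
\<close>

definition singular_value_seq :: "('a::complex_hilbert \<Rightarrow> 'a) \<Rightarrow> (nat \<Rightarrow> real) \<Rightarrow> bool" where
  "singular_value_seq X s \<longleftrightarrow>
    decseq s \<and> (\<forall>n. 0 \<le> s n) \<and>
    (\<forall>\<mu>>0. finite {n. s n = \<mu>} \<and>
      card {n. s n = \<mu>} = complex_vector.dim (eigenspace (abs_op X) (complex_of_real \<mu>)))"

lemma singular_value_seq_unique:
  assumes "singular_value_seq X s" "singular_value_seq X t"
  shows "s = t"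
proof -
  have le: "s n \<le> t n"
    if s: "singular_value_seq X s" and t: "singular_value_seq X t" and eq: "\<forall>i<n. s i = t i"
    for s t n
  proof (rule ccontr)
    assume "\<not> s n \<le> t n"
    then have less: "t n < s n" by simp
    then have pos: "0 < s n" using t by (metis singular_value_seq_def le_less_trans)
    have "{i. t i = s n} \<subset> {i. s i = s n}"
    proof -
      have "i < n" if "t i = s n" for i
        using that t less unfolding singular_value_seq_def decseq_def
        by (metis leD not_less)
      then show ?thesis using eq less by force
    qed
    moreover have "finite {i. s i = s n}" "card {i. t i = s n} = card {i. s i = s n}"
      using s t pos unfolding singular_value_seq_def by auto
    ultimately show False by (metis psubset_card_mono less_irrefl)
  qed
  have "s n = t n" for n
  proof (induction n rule: less_induct)
    case (less n)
    then show ?case using le[OF assms] le[OF assms(2,1)] by (metis order_antisym)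
  qed
  then show ?thesis by blast
qed

text \<open>The \<open>j\<close>-th singular value of a compact operator, for \<open>j = 1, 2, \<dots>\<close>.\<close>

definition singular_value :: "('a::complex_hilbert \<Rightarrow> 'a) \<Rightarrow> nat \<Rightarrow> real" where
  "singular_value X j = (THE s. singular_value_seq X s) (j - 1)"

end

theory Submission
  imports Defs
begin

text \<open>
  Write \<open>D = C T\<^sup>* C\<close>, so that \<open>A = (T + D) / 2\<close> and \<open>B = (T - D) / 2\<i>\<close>.  The adjoint of \<open>D\<close> is \<open>C T C\<close>, and
  \<open>C\<close>-normality says exactly that \<open>D\<^sup>* D = T\<^sup>* T\<close> and \<open>D D\<^sup>* = T T\<^sup>*\<close>.  Two things follow.

  First, \<open>norm (D x) = norm (T x)\<close>, and the parallelogram law gives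
  \<open>(norm (A x))\<^sup>2 + (norm (B x))\<^sup>2 = (norm (T x))\<^sup>2\<close>.  With \<open>P = |A|\<close> and \<open>Q = |B|\<close> this reads
  \<open>P\<^sup>2 + Q\<^sup>2 = |T|\<^sup>2\<close>.

  Second, \<open>T\<^sup>* T\<close> commutes with \<open>T\<^sup>* D\<close>, because
  \<open>T\<^sup>* D (D\<^sup>* D) = T\<^sup>* (D D\<^sup>*) D = T\<^sup>* (T T\<^sup>*) D = (T\<^sup>* T) T\<^sup>* D\<close>, and likewise with \<open>D\<^sup>* T\<close>.  Since \<open>4 A\<^sup>* A\<close> and
  \<open>4 B\<^sup>* B\<close> are \<open>2 T\<^sup>* T\<close> plus and minus \<open>T\<^sup>* D + D\<^sup>* T\<close>, the operators \<open>A\<^sup>* A\<close> and \<open>B\<^sup>* B\<close> commute, hence so do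
  their square roots \<open>P\<close> and \<open>Q\<close>, and therefore \<open>\<langle>P x, Q x\<rangle> \<ge> 0\<close>.

  Expanding the square, \<open>(norm ((P + Q) x))\<^sup>2 = (norm (T x))\<^sup>2 + 2 \<langle>P x, Q x\<rangle>\<close>.  The last term is nonnegative, and
  it is at most \<open>(norm (T x))\<^sup>2\<close> because \<open>(norm ((P - Q) x))\<^sup>2 \<ge> 0\<close>.  So
  \<open>norm (T x) \<le> norm ((P + Q) x) \<le> sqrt 2 * norm (T x)\<close> for every \<open>x\<close>, and the claim follows from the
  monotonicity of singular values (\<open>singular_value_mono\<close>).  The upper bound for
  the singular values of \<open>T\<close> depends on the commutation: for noncommuting positive \<open>P\<close> and \<open>Q\<close> an eigenvalue of
  \<open>P\<^sup>2 + Q\<^sup>2\<close> can exceed the corresponding one of \<open>(P + Q)\<^sup>2\<close>.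

  The spectral theory behind this rests on one construction.  A positive compact operator has a maximal
  eigenvector on the orthogonal complement of any set of its eigenvectors (\<open>maximal_eigenvector\<close>); iterating
  yields a Schmidt system, an orthogonal sequence of eigenvectors with decreasing eigenvalues that
  controls the operator on the complement of each initial segment.  Existence, uniqueness and commutation of square
  roots, the identification of the eigenvalues with the singular value sequence, and the min-max
  comparison of singular values are all read off from such systems.
\<close>

section \<open>Complex inner product spaces\<close>

lemma cinner_add_right: "cinner x (y + z) = cinner x y + cinner x z"
  by (metis cinner_commute cinner_add_left complex_cnj_add)

lemma cinner_scaleC_right: "cinner x (a *\<^sub>C y) = cnj a * cinner x y"
  by (metis cinner_commute cinner_scaleC_left complex_cnj_mult)

lemma cinner_scaleR_left: "cinner (r *\<^sub>R x) y = of_real r * cinner x y"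
  by (metis cinner_scaleC_left scaleC_of_real)

lemma cinner_scaleR_right: "cinner x (r *\<^sub>R y) = of_real r * cinner x y"
  by (metis cinner_scaleC_right scaleC_of_real complex_cnj_complex_of_real)

lemma cinner_zero_left [simp]: "cinner 0 y = 0"
  using cinner_scaleR_left[of 0 0 y] by simp

lemma cinner_zero_right [simp]: "cinner x 0 = 0"
  using cinner_scaleR_right[of x 0 0] by simp

lemma cinner_minus_left: "cinner (- x) y = - cinner x y"
  using cinner_scaleR_left[of "-1" x y] by simp

lemma cinner_minus_right: "cinner x (- y) = - cinner x y"
  using cinner_scaleR_right[of x "-1" y] by simp

lemma cinner_diff_left: "cinner (x - y) z = cinner x z - cinner y z"
  using cinner_add_left[of x "- y" z] by (simp add: cinner_minus_left)

lemma cinner_diff_right: "cinner x (y - z) = cinner x y - cinner x z"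
  using cinner_add_right[of x y "- z"] by (simp add: cinner_minus_right)

lemma cinner_sum_left: "cinner (\<Sum>i\<in>I. f i) y = (\<Sum>i\<in>I. cinner (f i) y)"
  by (induction I rule: infinite_finite_induct) (auto simp: cinner_add_left)

lemma Im_cinner: "Im (cinner x y) = inner x (\<i> *\<^sub>C y)"
  using Re_cinner[of x "\<i> *\<^sub>C y"] by (simp add: cinner_scaleC_right)

lemma cinner_eq_Complex: "cinner x y = Complex (inner x y) (inner x (\<i> *\<^sub>C y))"
  by (simp add: complex_eq_iff Re_cinner Im_cinner)

lemma cinner_self: "cinner x x = of_real ((norm x)\<^sup>2)"
proof -
  have "Im (cinner x x) = 0"
    using cinner_commute[of x x] by (metis complex_cnj_cancel_iff Reals_cnj_iff complex_is_Real_iff)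
  then show ?thesis
    by (simp add: complex_eq_iff Re_cinner power2_norm_eq_inner)
qed

lemma cinner_ext: "(\<And>x. cinner x y = cinner x z) \<Longrightarrow> y = z"
  using cinner_self[of "y - z"] by (simp add: cinner_diff_right)

lemma norm_scaleC: "norm (a *\<^sub>C x) = cmod a * norm x"
proof -
  have "cinner (a *\<^sub>C x) (a *\<^sub>C x) = of_real ((cmod a * norm x)\<^sup>2)"
    by (simp add: cinner_scaleC_left cinner_scaleC_right cinner_self[of x] power_mult_distrib
        complex_norm_square[of a] del: of_real_power)
  then have "(norm (a *\<^sub>C x))\<^sup>2 = (cmod a * norm x)\<^sup>2"
    unfolding cinner_self of_real_eq_iff .
  then show ?thesis by simp
qed

lemma tendsto_cinner_left: "(f \<longlongrightarrow> l) F \<Longrightarrow> ((\<lambda>n. cinner (f n) y) \<longlongrightarrow> cinner l y) F"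
  unfolding cinner_eq_Complex by (intro tendsto_intros)

lemma tendsto_scaleC: "(f \<longlongrightarrow> l) F \<Longrightarrow> ((\<lambda>n. a *\<^sub>C f n) \<longlongrightarrow> a *\<^sub>C l) F"
proof -
  assume "(f \<longlongrightarrow> l) F"
  moreover have "bounded_linear (\<lambda>x. a *\<^sub>C x)"
    by (rule bounded_linear_intro[where K = "cmod a"])
      (simp_all add: scaleC_add_right norm_scaleC scaleC_scaleC mult.commute flip: scaleC_of_real)
  ultimately show ?thesis by (rule bounded_linear.tendsto[rotated])
qed

lemma norm_sum_orthogonal:
  assumes "finite I" "\<And>i j. i \<in> I \<Longrightarrow> j \<in> I \<Longrightarrow> i \<noteq> j \<Longrightarrow> cinner (e i) (e j) = 0"
  shows "(norm (\<Sum>i\<in>I. c i *\<^sub>C e i))\<^sup>2 = (\<Sum>i\<in>I. (cmod (c i) * norm (e i))\<^sup>2)"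
  using assms
proof (induction I rule: finite_induct)
  case (insert j I)
  have "cinner (e i) (e j) = 0" if "i \<in> I" for i
    using insert.hyps insert.prems that by blast
  then have "cinner (\<Sum>i\<in>I. c i *\<^sub>C e i) (c j *\<^sub>C e j) = 0"
    by (simp add: cinner_sum_left cinner_scaleC_left cinner_scaleC_right)
  then have "inner (\<Sum>i\<in>I. c i *\<^sub>C e i) (c j *\<^sub>C e j) = 0"
    by (simp flip: Re_cinner)
  then have "(norm (c j *\<^sub>C e j + (\<Sum>i\<in>I. c i *\<^sub>C e i)))\<^sup>2 =
      (norm (c j *\<^sub>C e j))\<^sup>2 + (norm (\<Sum>i\<in>I. c i *\<^sub>C e i))\<^sup>2"
    by (simp add: power2_norm_eq_inner inner_simps inner_commute)
  with insert show ?case by (simp add: norm_scaleC)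
qed simp

section \<open>Adjoints\<close>

text \<open>
  The representing vector is the minimiser of \<open>(norm x)\<^sup>2 / 2 - f x\<close>: by the parallelogram law every
  minimising sequence is Cauchy, and at the minimum the derivative \<open>inner z y - f z\<close> vanishes in every
  direction \<open>z\<close>.
\<close>

lemma riesz_representation:
  fixes f :: "'a::{real_inner, complete_space} \<Rightarrow> real"
  assumes "bounded_linear f"
  shows "\<exists>y. \<forall>x. f x = inner x y"
proof -
  interpret f: bounded_linear f by fact
  obtain K where K: "K > 0" "\<And>x. \<bar>f x\<bar> \<le> norm x * K" using f.pos_bounded by auto
  define \<phi> where "\<phi> x = (norm x)\<^sup>2 / 2 - f x" for x
  have low: "- K\<^sup>2 / 2 \<le> \<phi> x" for x
  proof -
    have "0 \<le> (norm x - K)\<^sup>2" by simp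
    then show ?thesis using K(2)[of x] unfolding \<phi>_def by (simp add: power2_diff)
  qed
  then have bdd: "bdd_below (range \<phi>)" by (meson bdd_belowI2)
  define m where "m = (INF x. \<phi> x)"
  have m: "m \<le> \<phi> x" for x unfolding m_def using bdd by (simp add: cINF_lower)
  define \<delta> where "\<delta> n = inverse (real (Suc n))" for n
  have "\<exists>x. \<phi> x < m + \<delta> n" for n
    using cInf_lessD[of "range \<phi>" "m + \<delta> n"] unfolding m_def \<delta>_def by auto
  then obtain x where x: "\<And>n. \<phi> (x n) < m + \<delta> n" by metis
  have par: "(dist a b)\<^sup>2 \<le> 4 * ((\<phi> a - m) + (\<phi> b - m))" for a b
  proof -
    have "m \<le> \<phi> ((1/2) *\<^sub>R (a + b))" by (rule m)
    moreover have "f ((1/2) *\<^sub>R (a + b)) = (f a + f b) / 2"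
      by (simp add: f.add f.scaleR)
    moreover have "4 * (norm ((1/2) *\<^sub>R (a + b)))\<^sup>2 + (dist a b)\<^sup>2 = 2 * (norm a)\<^sup>2 + 2 * (norm b)\<^sup>2"
      unfolding dist_norm power2_norm_eq_inner
      by (simp add: inner_add_left inner_add_right inner_diff_left inner_diff_right inner_commute add_divide_distrib)
    ultimately show ?thesis
      unfolding \<phi>_def by (simp add: field_simps del: scaleR_half_double scaleR_add_right)
  qed
  have "Cauchy x"
  proof (rule metric_CauchyI)
    fix \<epsilon> :: real assume "\<epsilon> > 0"
    then obtain N where N: "\<delta> N < \<epsilon>\<^sup>2 / 8"
      using reals_Archimedean[of "\<epsilon>\<^sup>2 / 8"] unfolding \<delta>_def by auto
    have "dist (x i) (x j) < \<epsilon>" if "i \<ge> N" "j \<ge> N" for i j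
    proof -
      have "\<delta> i \<le> \<delta> N" "\<delta> j \<le> \<delta> N"
        using that by (simp_all add: \<delta>_def field_simps)
      then have "(dist (x i) (x j))\<^sup>2 < \<epsilon>\<^sup>2"
        using par[of "x i" "x j"] x[of i] x[of j] N by simp
      then show ?thesis using \<open>\<epsilon> > 0\<close> power2_less_imp_less less_imp_le by blast
    qed
    then show "\<exists>M. \<forall>i\<ge>M. \<forall>j\<ge>M. dist (x i) (x j) < \<epsilon>" by blast
  qed
  then obtain y where y: "x \<longlonglongrightarrow> y" using Cauchy_convergent_iff convergent_def by blast
  have "(\<lambda>n. \<phi> (x n)) \<longlonglongrightarrow> \<phi> y"
    unfolding \<phi>_def by (intro tendsto_intros y f.tendsto) simp
  moreover have "(\<lambda>n. m + \<delta> n) \<longlonglongrightarrow> m + 0"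
    unfolding \<delta>_def by (intro tendsto_intros LIMSEQ_inverse_real_of_nat)
  ultimately have min: "\<phi> y \<le> m"
    using x by (intro LIMSEQ_le[of "\<lambda>n. \<phi> (x n)" _ "\<lambda>n. m + \<delta> n"])
      (auto intro: less_imp_le)
  have "f z = inner z y" for z
  proof -
    define d where "d = inner z y - f z"
    \<comment> \<open>The exact minimiser over \<open>t\<close> divides by \<open>(norm z)\<^sup>2\<close>; the added \<open>1\<close> spares the case \<open>z = 0\<close>.\<close>
    define q where "q = (norm z)\<^sup>2 + 1"
    define t where "t = - d / q"
    have q: "q > 0" unfolding q_def by (simp add: add_nonneg_pos)
    have "\<phi> y \<le> \<phi> (y + t *\<^sub>R z)" using min m order_trans by blast
    moreover have "(norm (y + t *\<^sub>R z))\<^sup>2 = (norm y)\<^sup>2 + 2 * t * inner z y + t\<^sup>2 * (norm z)\<^sup>2"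
      unfolding power2_norm_eq_inner power2_eq_square[of t]
      by (simp add: inner_add_left inner_add_right inner_commute)
    ultimately have "0 \<le> t * d + t\<^sup>2 * (norm z)\<^sup>2 / 2"
      unfolding \<phi>_def d_def by (simp add: f.add f.scaleR algebra_simps)
    also have "\<dots> = - d\<^sup>2 * ((q + 1) / (2 * q\<^sup>2))"
    proof -
      have "(norm z)\<^sup>2 = q - 1" unfolding q_def by simp
      then show ?thesis
        unfolding t_def using q by (simp only:) (simp add: field_simps power2_eq_square)
    qed
    finally have "d\<^sup>2 * ((q + 1) / (2 * q\<^sup>2)) \<le> 0" by simp
    moreover have "(q + 1) / (2 * q\<^sup>2) > 0" using q by simp
    ultimately have "d\<^sup>2 \<le> 0"
      unfolding mult_le_0_iff by linarith
    then show ?thesis unfolding d_def by simp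
  qed
  then show ?thesis by blast
qed

lemma bounded_clinearD:
  assumes "bounded_clinear T"
  shows "bounded_linear T" "T (c *\<^sub>C x) = c *\<^sub>C T x" "T (x + y) = T x + T y"
    "T (x - y) = T x - T y" "T (r *\<^sub>R x) = r *\<^sub>R T x" "T 0 = 0" "T (- x) = - T x"
    "T (sum f I) = (\<Sum>i\<in>I. T (f i))"
    "f \<longlonglongrightarrow> l \<Longrightarrow> (\<lambda>n. T (f n)) \<longlonglongrightarrow> T l"
proof -
  show bl: "bounded_linear T" and "T (c *\<^sub>C x) = c *\<^sub>C T x"
    using assms unfolding bounded_clinear_def by auto
  interpret bounded_linear T by fact
  show "T (x + y) = T x + T y" by (rule add)
  show "T (x - y) = T x - T y" by (rule diff)
  show "T (r *\<^sub>R x) = r *\<^sub>R T x" by (rule scaleR)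
  show "T 0 = 0" by (rule zero)
  show "T (- x) = - T x" by (rule neg)
  show "T (sum f I) = (\<Sum>i\<in>I. T (f i))" by (rule sum)
  show "(\<lambda>n. T (f n)) \<longlonglongrightarrow> T l" if "f \<longlonglongrightarrow> l" using that by (rule tendsto)
qed

lemma bounded_clinear_compose:
  "bounded_clinear S \<Longrightarrow> bounded_clinear T \<Longrightarrow> bounded_clinear (S \<circ> T)"
  unfolding bounded_clinear_def comp_def using bounded_linear_compose[of S T] by simp

lemma bounded_clinear_intro:
  assumes "\<And>x y. T (x + y) = T x + T y" "\<And>c x. T (c *\<^sub>C x) = c *\<^sub>C T x"
    "\<And>x. norm (T x) \<le> norm x * K"
  shows "bounded_clinear T"
  unfolding bounded_clinear_def
  using assms by (auto intro!: bounded_linear_intro[where K = K] simp flip: scaleC_of_real)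

text \<open>
  Riesz representation supplies the adjoint for the real inner product; complex linearity of \<open>T\<close> makes it
  the adjoint for the complex one.
\<close>

lemma adjoint_ex:
  fixes T :: "'a::complex_hilbert \<Rightarrow> 'a"
  assumes T: "bounded_clinear T"
  shows "\<exists>S. \<forall>x y. cinner (T x) y = cinner x (S y)"
proof -
  have "\<exists>z. \<forall>x. inner (T x) y = inner x z" for y
    by (rule riesz_representation)
      (intro bounded_linear_compose[OF bounded_linear_inner_left bounded_clinearD(1)[OF T], unfolded comp_def])
  then obtain S where S: "\<And>x y. inner (T x) y = inner x (S y)" by metis
  \<comment> \<open>The imaginary part of the inner product is the real part after rotating the first argument.\<close>
  have rot: "Im (cinner u v) = inner (- \<i> *\<^sub>C u) v" for u v :: 'a
    using Re_cinner[of "- \<i> *\<^sub>C u" v] by (simp add: cinner_scaleC_left cinner_minus_left)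
  have "cinner (T x) y = cinner x (S y)" for x y
    using S[of "\<i> *\<^sub>C x" y]
    by (simp add: complex_eq_iff Re_cinner S rot bounded_clinearD(2)[OF T])
  then show ?thesis by blast
qed

lemma cadjoint_eqI:
  assumes "\<And>x y. cinner (T x) y = cinner x (S y)"
  shows "cadjoint T = S"
  unfolding cadjoint_def
proof (rule the_equality)
  show "S' = S" if "\<forall>x y. cinner (T x) y = cinner x (S' y)" for S'
    by (rule ext, rule cinner_ext) (simp flip: assms that[rule_format])
qed (use assms in blast)

lemma cinner_cadjoint:
  assumes "bounded_clinear T"
  shows "cinner (T x) y = cinner x (cadjoint T y)" "cinner x (T y) = cinner (cadjoint T x) y"
proof -
  obtain S where S: "\<And>x y. cinner (T x) y = cinner x (S y)"
    using adjoint_ex[OF assms] by blast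
  then show *: "cinner (T x) y = cinner x (cadjoint T y)" for x y
    by (simp add: cadjoint_eqI)
  show "cinner x (T y) = cinner (cadjoint T x) y"
    using *[of y x] cinner_commute[of x "T y"] cinner_commute[of "cadjoint T x" y] by simp
qed

lemma bounded_clinear_cadjoint:
  assumes T: "bounded_clinear T"
  shows "bounded_clinear (cadjoint T)"
proof -
  obtain K where K: "K > 0" "\<And>x. norm (T x) \<le> norm x * K"
    using bounded_linear.pos_bounded[OF bounded_clinearD(1)[OF T]] by blast
  show ?thesis
  proof (rule bounded_clinear_intro[where K = K])
    show "cadjoint T (x + y) = cadjoint T x + cadjoint T y" for x y
      by (rule cinner_ext) (simp add: cinner_cadjoint(1)[OF T, symmetric] cinner_add_right)
    show "cadjoint T (c *\<^sub>C x) = c *\<^sub>C cadjoint T x" for c x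
      by (rule cinner_ext) (simp add: cinner_cadjoint(1)[OF T, symmetric] cinner_scaleC_right)
    show "norm (cadjoint T x) \<le> norm x * K" for x
    proof -
      have "(norm (cadjoint T x))\<^sup>2 = inner (T (cadjoint T x)) x"
        by (metis Re_cinner cinner_cadjoint(1)[OF T] power2_norm_eq_inner)
      also have "\<dots> \<le> norm (cadjoint T x) * K * norm x"
        by (meson K(2) norm_cauchy_schwarz order_trans mult_right_mono norm_ge_zero)
      finally have "norm (cadjoint T x) * norm (cadjoint T x) \<le> norm (cadjoint T x) * (norm x * K)"
        by (simp add: power2_eq_square mult_ac)
      then show ?thesis
        using K(1) by (cases "norm (cadjoint T x) = 0") (auto simp: mult_le_cancel_left)
    qed
  qed
qed

lemma cadjoint_cadjoint: "bounded_clinear T \<Longrightarrow> cadjoint (cadjoint T) = T"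
  by (intro cadjoint_eqI) (simp add: cinner_cadjoint)

section \<open>Compactness along sequences\<close>

text \<open>
  Compactness of an operator in the form in which it is used, as extraction of convergent subsequences.
  In this form it passes directly along norm inequalities between operators.
\<close>

definition seq_compact_op :: "('a::complex_inner \<Rightarrow> 'b::complex_inner) \<Rightarrow> bool" where
  "seq_compact_op K \<longleftrightarrow>
    (\<forall>x. (\<forall>n. norm (x n) \<le> 1) \<longrightarrow> (\<exists>r l. strict_mono (r :: nat \<Rightarrow> nat) \<and> (\<lambda>n. K (x (r n))) \<longlonglongrightarrow> l))"

lemma compact_op_imp_seq_compact_op:
  assumes "compact_op T"
  shows "seq_compact_op T"
  unfolding seq_compact_op_def
proof safe
  fix x :: "nat \<Rightarrow> 'a" assume "\<forall>n. norm (x n) \<le> 1"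
  then have "\<forall>n. T (x n) \<in> closure (T ` cball 0 1)"
    using closure_subset by fastforce
  moreover have "seq_compact (closure (T ` cball 0 1))"
    using assms compact_imp_seq_compact unfolding compact_op_def by blast
  ultimately show "\<exists>r l. strict_mono r \<and> (\<lambda>n. T (x (r n))) \<longlonglongrightarrow> l"
    unfolding seq_compact_def comp_def by meson
qed

text \<open>
  If \<open>K\<close> maps a sequence to a convergent one, then \<open>L\<close> maps it to a Cauchy sequence.  This
  gives the compactness of \<open>|X|\<close>, of \<open>X\<^sup>* X\<close>, of the Cartesian parts and of \<open>|A| + |B|\<close> from norm
  inequalities alone.
\<close>

lemma seq_compact_op_dominated:
  fixes K L :: "'a::complex_hilbert \<Rightarrow> 'a"
  assumes K: "seq_compact_op K" "bounded_clinear K" and L: "bounded_clinear L"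
    and dom: "\<And>x. norm (L x) \<le> c * norm (K x)"
  shows "seq_compact_op L"
  unfolding seq_compact_op_def
proof safe
  fix x :: "nat \<Rightarrow> 'a" assume "\<forall>n. norm (x n) \<le> 1"
  then obtain r l where r: "strict_mono r" "(\<lambda>n. K (x (r n))) \<longlonglongrightarrow> l"
    using K(1) unfolding seq_compact_op_def by metis
  then have Cauchy: "Cauchy (\<lambda>n. K (x (r n)))" by (simp add: LIMSEQ_imp_Cauchy)
  have "Cauchy (\<lambda>n. L (x (r n)))"
  proof (rule metric_CauchyI)
    fix \<epsilon> :: real assume "\<epsilon> > 0"
    then have "\<epsilon> / (\<bar>c\<bar> + 1) > 0" by simp
    then obtain N where N: "\<And>m n. m \<ge> N \<Longrightarrow> n \<ge> N \<Longrightarrow> dist (K (x (r m))) (K (x (r n))) < \<epsilon> / (\<bar>c\<bar> + 1)"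
      using metric_CauchyD[OF Cauchy] by meson
    have "dist (L (x (r m))) (L (x (r n))) < \<epsilon>" if "m \<ge> N" "n \<ge> N" for m n
    proof -
      have "dist (L (x (r m))) (L (x (r n))) \<le> c * dist (K (x (r m))) (K (x (r n)))"
        using dom[of "x (r m) - x (r n)"]
        by (simp add: dist_norm bounded_clinearD(4)[OF K(2)] bounded_clinearD(4)[OF L])
      also have "\<dots> \<le> (\<bar>c\<bar> + 1) * dist (K (x (r m))) (K (x (r n)))"
        by (intro mult_right_mono) auto
      also have "\<dots> < \<epsilon>"
        using N[OF that] by (simp add: field_simps)
      finally show ?thesis .
    qed
    then show "\<exists>M. \<forall>m\<ge>M. \<forall>n\<ge>M. dist (L (x (r m))) (L (x (r n))) < \<epsilon>" by blast
  qed
  then obtain l' where "(\<lambda>n. L (x (r n))) \<longlonglongrightarrow> l'"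
    using Cauchy_convergent_iff convergent_def by blast
  with r(1) show "\<exists>r l. strict_mono r \<and> (\<lambda>n. L (x (r n))) \<longlonglongrightarrow> l" by blast
qed

lemma seq_compact_op_compose:
  fixes K L :: "'a::complex_hilbert \<Rightarrow> 'a"
  assumes K: "seq_compact_op K" "bounded_clinear K" and L: "bounded_clinear L"
  shows "seq_compact_op (K \<circ> L)"
  unfolding seq_compact_op_def
proof safe
  fix x :: "nat \<Rightarrow> 'a" assume x: "\<forall>n. norm (x n) \<le> 1"
  obtain M where M: "M > 0" "\<And>x. norm (L x) \<le> norm x * M"
    using bounded_linear.pos_bounded[OF bounded_clinearD(1)[OF L]] by blast
  have "norm ((1 / M) *\<^sub>R L (x n)) \<le> 1" for n
  proof -
    have "norm (L (x n)) \<le> M" 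
      using order_trans[OF M(2)[of "x n"] mult_right_mono[of "norm (x n)" 1 M]] x M(1) by simp
    then show ?thesis using M(1) by simp
  qed
  then obtain r l where r: "strict_mono r" "(\<lambda>n. K ((1 / M) *\<^sub>R L (x (r n)))) \<longlonglongrightarrow> l"
    using K(1)[unfolded seq_compact_op_def, rule_format, of "\<lambda>n. (1 / M) *\<^sub>R L (x n)"] by blast
  have "(\<lambda>n. M *\<^sub>R K ((1 / M) *\<^sub>R L (x (r n)))) \<longlonglongrightarrow> M *\<^sub>R l"
    by (intro tendsto_intros r(2))
  then have "(\<lambda>n. (K \<circ> L) (x (r n))) \<longlonglongrightarrow> M *\<^sub>R l"
    using M(1) by (simp add: bounded_clinearD(5)[OF K(2)])
  with r(1) show "\<exists>r l. strict_mono r \<and> (\<lambda>n. (K \<circ> L) (x (r n))) \<longlonglongrightarrow> l" by blast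
qed

section \<open>Positive operators\<close>

text \<open>
  A positive operator on a complex space is self-adjoint by polarisation: that \<open>cinner (R z) z\<close> is real for
  \<open>z = x + y\<close> determines the imaginary part of \<open>cinner (R x) y\<close>, and replacing \<open>y\<close> by \<open>\<i> y\<close> its real part.
\<close>

lemma positive_opD:
  assumes "positive_op R"
  shows "bounded_clinear R" "0 \<le> inner (R x) x" "cinner (R x) y = cinner x (R y)"
    "inner (R x) y = inner x (R y)"
proof -
  show R: "bounded_clinear R" using assms unfolding positive_op_def by blast
  have pos: "Im (cinner (R x) x) = 0" "0 \<le> Re (cinner (R x) x)" for x
    using assms unfolding positive_op_def complex_nonneg_Reals_iff by auto
  then show "0 \<le> inner (R x) x" by (simp add: Re_cinner)
  have Im: "Im (cinner (R x) y) = - Im (cinner (R y) x)" for x y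
    using pos(1)[of "x + y"] pos(1)[of x] pos(1)[of y]
    by (simp add: bounded_clinearD(3)[OF R] cinner_add_left cinner_add_right)
  have Re: "Re (cinner (R x) y) = Re (cinner (R y) x)"
    using Im[of x "\<i> *\<^sub>C y"]
    by (simp add: bounded_clinearD(2)[OF R] cinner_scaleC_left cinner_scaleC_right)
  show sym: "cinner (R x) y = cinner x (R y)"
    using cinner_commute[of x "R y"] Im[of x y] Re by (simp add: complex_eq_iff)
  then show "inner (R x) y = inner x (R y)" by (simp flip: Re_cinner)
qed

lemma positive_op_intro:
  assumes "bounded_clinear R" "\<And>x y. cinner (R x) y = cinner x (R y)" "\<And>x. 0 \<le> inner (R x) x"
  shows "positive_op R"
proof -
  have "Im (cinner (R x) x) = 0" for x
    using cinner_commute[of "R x" x] assms(2)[of x x] by (simp add: complex_eq_iff)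
  then show ?thesis
    using assms(1,3) unfolding positive_op_def complex_nonneg_Reals_iff Re_cinner by blast
qed

text \<open>
  Expanding the inequality \<open>0 \<le> \<langle>R z, z\<rangle>\<close> for \<open>z = x - R x / M\<close> gives the claim.  The bound on the quadratic form
  is asked for at \<open>R x\<close> alone, which lets the lemma be applied on an invariant subspace.
\<close>

lemma positive_op_norm_le:
  assumes R: "positive_op R" and "M > 0" and le: "inner (R (R x)) (R x) \<le> M * (norm (R x))\<^sup>2"
  shows "(norm (R x))\<^sup>2 \<le> M * inner (R x) x"
proof -
  define t where "t = 1 / M"
  note R' = bounded_clinearD[OF positive_opD(1)[OF R]]
  have "0 \<le> inner (R (x - t *\<^sub>R R x)) (x - t *\<^sub>R R x)" by (rule positive_opD(2)[OF R])
  also have "\<dots> = inner (R x) x - 2 * t * (norm (R x))\<^sup>2 + t\<^sup>2 * inner (R (R x)) (R x)"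
    using positive_opD(4)[OF R, of "R x" x]
    by (simp add: R' inner_diff_left inner_diff_right power2_norm_eq_inner inner_commute power2_eq_square[of t])
  also have "\<dots> \<le> inner (R x) x - 2 * t * (norm (R x))\<^sup>2 + t\<^sup>2 * (M * (norm (R x))\<^sup>2)"
    by (intro add_left_mono mult_left_mono le) simp
  also have "\<dots> = inner (R x) x - (norm (R x))\<^sup>2 / M"
    using \<open>M > 0\<close> unfolding t_def by (simp add: field_simps power2_eq_square)
  finally show ?thesis using \<open>M > 0\<close> by (simp add: field_simps)
qed

text \<open>
  The vector \<open>y = S v - t v\<close> satisfies \<open>S y = - t y\<close>, and a positive operator has no negative eigenvalue.
\<close>

lemma positive_sqrt_eigenvector:
  assumes S: "positive_op S" and "S (S v) = (t * t) *\<^sub>R v" and "t > 0"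
  shows "S v = t *\<^sub>R v"
proof -
  define y where "y = S v - t *\<^sub>R v"
  have "S y = - t *\<^sub>R y"
    unfolding y_def by (simp add: bounded_clinearD[OF positive_opD(1)[OF S]] assms(2) algebra_simps)
  then have "t * inner y y \<le> 0" using positive_opD(2)[OF S, of y] by simp
  then have "inner y y = 0" using \<open>t > 0\<close> inner_ge_zero[of y] by (simp only: mult_le_0_iff) auto
  then have "y = 0" by simp
  then show ?thesis unfolding y_def by simp
qed

text \<open>
  The value \<open>s\<close> is the supremum of \<open>\<langle>R x, x\<rangle>\<close> over the unit ball of \<open>W\<close>.  For a maximising sequence,
  \<open>(norm (R x - s x))\<^sup>2 \<le> 2 s (s - \<langle>R x, x\<rangle>)\<close> tends to zero; so once a subsequence of the images \<open>R x\<close> converges, so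
  does the corresponding subsequence of the \<open>x\<close>, and its limit is the eigenvector.  If \<open>s = 0\<close>, then \<open>R\<close>
  vanishes on \<open>W\<close>, and the zero vector is taken.
\<close>

lemma maximal_eigenvector:
  fixes R :: "'a::complex_hilbert \<Rightarrow> 'a"
  assumes R: "positive_op R" "seq_compact_op R"
    and V: "\<And>v. v \<in> V \<Longrightarrow> \<exists>c::real. R v = c *\<^sub>R v"
    and W: "W = {x. \<forall>v\<in>V. cinner x v = 0}"
  shows "\<exists>e s. e \<in> W \<and> R e = s *\<^sub>R e \<and> 0 \<le> s \<and> norm e = (if s = 0 then 0 else 1) \<and>
    (\<forall>x\<in>W. norm (R x) \<le> s * norm x)"
proof -
  note R' = bounded_clinearD[OF positive_opD(1)[OF R(1)]]
  have W0: "0 \<in> W" unfolding W by simp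
  have W_scale: "c *\<^sub>R x \<in> W" if "x \<in> W" for c x
    using that unfolding W by (simp add: cinner_scaleR_left)
  have W_inv: "R x \<in> W" if "x \<in> W" for x
    unfolding W
  proof safe
    fix v assume "v \<in> V"
    then obtain c :: real where "R v = c *\<^sub>R v" using V by blast
    with \<open>v \<in> V\<close> that show "cinner (R x) v = 0"
      unfolding W by (simp add: positive_opD(3)[OF R(1)] cinner_scaleR_right)
  qed
  have W_closed: "l \<in> W" if "\<And>n. f n \<in> W" "f \<longlonglongrightarrow> l" for f :: "nat \<Rightarrow> 'a" and l
    unfolding W
  proof safe
    fix v assume "v \<in> V"
    then have "(\<lambda>n. cinner (f n) v) = (\<lambda>n. 0)" using that(1) unfolding W by auto
    then show "cinner l v = 0"
      using tendsto_cinner_left[OF that(2), of v] by (simp add: LIMSEQ_const_iff)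
  qed
  define U where "U = {x \<in> W. norm x \<le> 1}"
  define s where "s = (SUP x\<in>U. inner (R x) x)"
  obtain K where K: "K > 0" "\<And>x. norm (R x) \<le> norm x * K"
    using bounded_linear.pos_bounded[OF R'(1)] by blast
  have "inner (R x) x \<le> K" if "x \<in> U" for x
  proof -
    have "inner (R x) x \<le> norm (R x) * norm x" by (rule norm_cauchy_schwarz)
    also have "\<dots> \<le> (1 * K) * 1"
      using that K order_trans[OF K(2)[of x] mult_right_mono[of "norm x" 1 K]]
      unfolding U_def by (intro mult_mono) auto
    finally show ?thesis by simp
  qed
  then have bdd: "bdd_above ((\<lambda>x. inner (R x) x) ` U)" by (meson bdd_aboveI2)
  have upper: "inner (R x) x \<le> s" if "x \<in> U" for x
    unfolding s_def using that bdd by (rule cSUP_upper)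
  have s_nonneg: "0 \<le> s" using upper[of 0] W0 R'(6) unfolding U_def by simp
  have quad: "inner (R x) x \<le> s * (norm x)\<^sup>2" if "x \<in> W" for x
  proof (cases "x = 0")
    case False
    have "(1 / norm x) *\<^sub>R x \<in> U" using False W_scale[OF that] unfolding U_def by simp
    from upper[OF this] show ?thesis
      using False by (simp add: R' power2_eq_square field_simps)
  qed (simp add: R')
  have normR: "norm (R x) \<le> s * norm x" if "x \<in> W" for x
  proof (rule field_le_epsilon)
    fix \<epsilon> :: real assume "\<epsilon> > 0"
    \<comment> \<open>The bound is proved with a strictly positive \<open>M\<close> slightly above \<open>s\<close>, because \<open>s\<close> may be zero.\<close>
    define M where "M = s + \<epsilon> / (norm x + 1)"
    have "\<epsilon> / (norm x + 1) > 0" using \<open>\<epsilon> > 0\<close> by (simp add: add_nonneg_pos)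
    then have M: "M > 0" "s \<le> M" unfolding M_def using s_nonneg by auto
    have quadM: "inner (R y) y \<le> M * (norm y)\<^sup>2" if "y \<in> W" for y
      using quad[OF that] mult_right_mono[OF M(2), of "(norm y)\<^sup>2"] by simp
    have "(norm (R x))\<^sup>2 \<le> M * inner (R x) x"
      by (rule positive_op_norm_le[OF R(1) M(1) quadM[OF W_inv[OF that]]])
    also have "\<dots> \<le> M * (M * (norm x)\<^sup>2)"
      using quadM[OF that] M(1) by simp
    also have "\<dots> = (M * norm x)\<^sup>2" by (simp add: power2_eq_square)
    finally have "norm (R x) \<le> M * norm x"
      using M(1) by (simp add: power2_le_iff_abs_le)
    also have "\<dots> = s * norm x + \<epsilon> * (norm x / (norm x + 1))" unfolding M_def by (simp add: algebra_simps)
    also have "\<dots> \<le> s * norm x + \<epsilon> * 1"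
      using \<open>\<epsilon> > 0\<close> by (intro add_left_mono mult_left_mono) (simp_all add: divide_le_eq_1 add_nonneg_pos)
    finally show "norm (R x) \<le> s * norm x + \<epsilon>" by simp
  qed
  show ?thesis
  proof (cases "s = 0")
    case True
    then show ?thesis using W0 normR R'(6) by (intro exI[of _ 0]) auto
  next
    case False
    with s_nonneg have s: "s > 0" by simp
    have "\<exists>x\<in>U. s - inverse (real (Suc n)) < inner (R x) x" for n
    proof -
      have "U \<noteq> {}" using W0 unfolding U_def by auto
      then show ?thesis
        using less_cSUP_iff[OF _ bdd, of "s - inverse (real (Suc n))"] unfolding s_def[symmetric] by simp
    qed
    then obtain x where x: "\<And>n. x n \<in> U" "\<And>n. s - inverse (real (Suc n)) < inner (R (x n)) (x n)" by metis
    have lim: "(\<lambda>n. inner (R (x n)) (x n)) \<longlonglongrightarrow> s"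
    proof (rule real_tendsto_sandwich)
      show "\<forall>\<^sub>F n in sequentially. s - inverse (real (Suc n)) \<le> inner (R (x n)) (x n)"
        using x(2) by (simp add: less_imp_le)
      show "\<forall>\<^sub>F n in sequentially. inner (R (x n)) (x n) \<le> s" using upper x(1) by simp
      show "(\<lambda>n. s - inverse (real (Suc n))) \<longlonglongrightarrow> s"
        using tendsto_diff[OF tendsto_const LIMSEQ_inverse_real_of_nat] by simp
    qed (rule tendsto_const)
    have sq: "(norm (R (x n) - s *\<^sub>R x n))\<^sup>2 \<le> 2 * s * (s - inner (R (x n)) (x n))" for n
    proof -
      have n: "norm (x n) \<le> 1" "x n \<in> W" using x(1) unfolding U_def by auto
      have "(norm (R (x n) - s *\<^sub>R x n))\<^sup>2 = (norm (R (x n)))\<^sup>2 - 2 * s * inner (R (x n)) (x n) + s\<^sup>2 * (norm (x n))\<^sup>2"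
        unfolding power2_norm_eq_inner power2_eq_square[of s]
        by (simp add: inner_diff_left inner_diff_right inner_commute)
      also have "\<dots> \<le> s\<^sup>2 - 2 * s * inner (R (x n)) (x n) + s\<^sup>2 * 1"
      proof (intro add_mono diff_mono mult_left_mono)
        have "norm (R (x n)) \<le> s * 1"
          using normR[OF n(2)] n(1) s by (meson order_trans mult_left_mono less_imp_le)
        then show "(norm (R (x n)))\<^sup>2 \<le> s\<^sup>2" by (simp add: power_mono)
        show "(norm (x n))\<^sup>2 \<le> 1" using n(1) by (simp add: power_le_one)
      qed (use s in simp_all)
      also have "\<dots> = 2 * s * (s - inner (R (x n)) (x n))" by (simp add: algebra_simps power2_eq_square)
      finally show ?thesis .
    qed
    have "(\<lambda>n. 2 * s * (s - inner (R (x n)) (x n))) \<longlonglongrightarrow> 2 * s * (s - s)"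
      by (rule tendsto_mult_left[OF tendsto_diff[OF tendsto_const lim]])
    then have "(\<lambda>n. (norm (R (x n) - s *\<^sub>R x n))\<^sup>2) \<longlonglongrightarrow> 0"
      using sq by - (rule Lim_null_comparison[OF always_eventually], auto)
    then have "(\<lambda>n. sqrt ((norm (R (x n) - s *\<^sub>R x n))\<^sup>2)) \<longlonglongrightarrow> sqrt 0"
      by (rule tendsto_real_sqrt)
    then have diff: "(\<lambda>n. R (x n) - s *\<^sub>R x n) \<longlonglongrightarrow> 0"
      by (simp add: tendsto_norm_zero_iff)
    obtain r y where r: "strict_mono r" "(\<lambda>n. R (x (r n))) \<longlonglongrightarrow> y"
      using R(2) x(1) unfolding seq_compact_op_def U_def by blast
    have "(\<lambda>n. (1 / s) *\<^sub>R (R (x (r n)) - (R (x (r n)) - s *\<^sub>R x (r n)))) \<longlonglongrightarrow> (1 / s) *\<^sub>R (y - 0)"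
      using LIMSEQ_subseq_LIMSEQ[OF diff r(1)] by (intro tendsto_intros r(2)) (simp add: comp_def)
    then have xe: "(\<lambda>n. x (r n)) \<longlonglongrightarrow> (1 / s) *\<^sub>R y" using s by simp
    define e where "e = (1 / s) *\<^sub>R y"
    have e: "(\<lambda>n. x (r n)) \<longlonglongrightarrow> e" "e \<in> W"
      using xe W_closed[OF _ xe] x(1) unfolding e_def U_def by auto
    have Re: "R e = s *\<^sub>R e"
      using LIMSEQ_unique[OF R'(9)[OF e(1)] r(2)] s unfolding e_def by simp
    have "(\<lambda>n. inner (R (x (r n))) (x (r n))) \<longlonglongrightarrow> inner (R e) e"
      by (intro tendsto_inner e R'(9))
    then have "inner (R e) e = s"
      using LIMSEQ_unique LIMSEQ_subseq_LIMSEQ[OF lim r(1)] unfolding comp_def by blast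
    then have "(norm e)\<^sup>2 = 1" using s unfolding Re by (simp add: power2_norm_eq_inner)
    then have "norm e = 1" using norm_ge_zero[of e] by (auto simp: power2_eq_1_iff)
    then show ?thesis using e Re s normR by (intro exI[of _ e] exI[of _ s]) auto
  qed
qed

section \<open>Schmidt systems\<close>

text \<open>
  The vectors \<open>e n\<close> with \<open>s n \<noteq> 0\<close> form an orthonormal basis, ordered by decreasing eigenvalue, of the closure
  of the range of \<open>R\<close>.  If the rank of \<open>R\<close> is finite, the sequence is padded with \<open>e n = 0\<close> and
  \<open>s n = 0\<close>, so that finite and infinite rank are treated alike.  The last condition is the maximality of \<open>s n\<close>, which contains the spectral theorem.
\<close>

locale schmidt_system =
  fixes R :: "'a::complex_hilbert \<Rightarrow> 'a" and e :: "nat \<Rightarrow> 'a" and s :: "nat \<Rightarrow> real"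
  assumes positive: "positive_op R" and seq_compact: "seq_compact_op R"
    and eigen: "R (e n) = s n *\<^sub>R e n" and s_nonneg: "0 \<le> s n"
    and norm_e: "norm (e n) = (if s n = 0 then 0 else 1)"
    and orthogonal: "m \<noteq> n \<Longrightarrow> cinner (e m) (e n) = 0"
    and norm_le: "(\<And>k. k < n \<Longrightarrow> cinner x (e k) = 0) \<Longrightarrow> norm (R x) \<le> s n * norm x"

text \<open>
  Choose recursively a maximal eigenvector orthogonal to all earlier ones.
\<close>

lemma schmidt_system_exists:
  fixes R :: "'a::complex_hilbert \<Rightarrow> 'a"
  assumes R: "positive_op R" "seq_compact_op R"
  shows "\<exists>e s. schmidt_system R e s"
proof -
  define P where "P f n r \<longleftrightarrow> R (fst r) = snd r *\<^sub>R fst r \<and> 0 \<le> snd r \<and>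
    norm (fst r) = (if snd r = 0 then 0 else 1) \<and> (\<forall>k\<in>{..<n}. cinner (fst r) (fst (f k)) = 0) \<and>
    (\<forall>x. (\<forall>k\<in>{..<n}. cinner x (fst (f k)) = 0) \<longrightarrow> norm (R x) \<le> snd r * norm x)"
    for f :: "nat \<Rightarrow> 'a \<times> real" and n :: nat and r :: "'a \<times> real"
  have "\<exists>f. \<forall>n. P f n (f n)"
  proof (rule dependent_wellorder_choice)
    show "P f n r = P g n r" if "\<And>k. k < n \<Longrightarrow> f k = g k" for f g n r
      using that unfolding P_def by simp
    show "\<exists>r. P f n r" if "\<And>k. k < n \<Longrightarrow> P f k (f k)" for f n
    proof -
      let ?W = "{x. \<forall>v\<in>(\<lambda>k. fst (f k)) ` {..<n}. cinner x v = 0}"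
      have "\<exists>e s. e \<in> ?W \<and> R e = s *\<^sub>R e \<and> 0 \<le> s \<and> norm e = (if s = 0 then 0 else 1) \<and>
          (\<forall>x\<in>?W. norm (R x) \<le> s * norm x)"
        by (rule maximal_eigenvector[OF R _ refl]) (use that in \<open>auto simp: P_def\<close>)
      then obtain e s where "P f n (e, s)" unfolding P_def by auto
      then show ?thesis ..
    qed
  qed
  then obtain f where f: "\<And>n. P f n (f n)" by blast
  have less: "cinner (fst (f n)) (fst (f m)) = 0" if "m < n" for m n
    using f[of n] that unfolding P_def by (meson lessThan_iff)
  have "schmidt_system R (\<lambda>n. fst (f n)) (\<lambda>n. snd (f n))"
  proof
    show "cinner (fst (f m)) (fst (f n)) = 0" if "m \<noteq> n" for m n
      using less[of m n] less[of n m] that cinner_commute[of "fst (f m)" "fst (f n)"]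
      by (cases "m < n") auto
  qed (use R f in \<open>auto simp: P_def\<close>)
  then show ?thesis by blast
qed

context schmidt_system
begin

lemmas R_clinear = positive_opD(1)[OF positive]

lemma decseq_s: "decseq s"
  unfolding decseq_def
proof safe
  fix m n :: nat assume "m \<le> n"
  show "s n \<le> s m"
  proof (cases "s n = 0")
    case False
    have "norm (R (e n)) \<le> s m * norm (e n)"
      by (rule norm_le) (use \<open>m \<le> n\<close> orthogonal in auto)
    then show ?thesis using False s_nonneg[of n] norm_e[of n] by (simp add: eigen)
  qed (simp add: s_nonneg)
qed

text \<open>
  If the eigenvalues stayed above some \<open>l > 0\<close>, the images \<open>R (e n)\<close> would be orthogonal of norm at least
  \<open>l\<close> and could not have a Cauchy subsequence.
\<close>

lemma s_tendsto_zero: "s \<longlonglongrightarrow> 0"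
proof -
  obtain l where l: "s \<longlonglongrightarrow> l" "\<And>n. l \<le> s n"
    using decseq_convergent[OF decseq_s, of 0] s_nonneg by blast
  have "l \<ge> 0" using LIMSEQ_le_const[OF l(1)] s_nonneg by blast
  moreover have "\<not> l > 0"
  proof
    assume "l > 0"
    then have s: "s n > 0" for n using l(2)[of n] by simp
    then have norm1: "norm (e n) = 1" for n using norm_e[of n] by (metis less_irrefl)
    then obtain r y where r: "strict_mono r" "(\<lambda>n. R (e (r n))) \<longlonglongrightarrow> y"
      using seq_compact unfolding seq_compact_op_def by (metis order_refl)
    then have "Cauchy (\<lambda>n. R (e (r n)))" by (simp add: LIMSEQ_imp_Cauchy)
    then obtain N where N: "dist (R (e (r m))) (R (e (r n))) < l" if "m \<ge> N" "n \<ge> N" for m n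
      using metric_CauchyD \<open>l > 0\<close> by metis
    have neq: "r N \<noteq> r (Suc N)" using r(1) by (simp add: strict_mono_eq)
    then have "inner (R (e (r N))) (R (e (r (Suc N)))) = 0"
      using orthogonal by (simp add: eigen cinner_scaleR_left cinner_scaleR_right flip: Re_cinner)
    moreover have "inner (e n) (e n) = 1" for n using norm1[of n] by (simp flip: power2_norm_eq_inner)
    ultimately have "(dist (R (e (r N))) (R (e (r (Suc N)))))\<^sup>2 = (s (r N))\<^sup>2 + (s (r (Suc N)))\<^sup>2"
      unfolding dist_norm power2_norm_eq_inner inner_diff_left inner_diff_right
      by (auto simp: inner_commute eigen power2_eq_square)
    moreover have "l\<^sup>2 \<le> (s (r N))\<^sup>2" using l(2)[of "r N"] \<open>l > 0\<close> by (simp add: power_mono)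
    ultimately have "l\<^sup>2 \<le> (dist (R (e (r N))) (R (e (r (Suc N)))))\<^sup>2"
      using zero_le_power2[of "s (r (Suc N))"] by linarith
    then have "l \<le> dist (R (e (r N))) (R (e (r (Suc N))))"
      using power2_le_imp_le zero_le_dist by blast
    with N[of N "Suc N"] show False by simp
  qed
  ultimately show ?thesis using l(1) by simp
qed

lemma cinner_e_e: "cinner (e m) (e n) = (if m = n \<and> s n \<noteq> 0 then 1 else 0)"
  using norm_e[of n] orthogonal[of m n] by (auto simp: cinner_self)

definition proj :: "nat set \<Rightarrow> 'a \<Rightarrow> 'a" where
  "proj I x = (\<Sum>k\<in>I. cinner x (e k) *\<^sub>C e k)"

lemma e_eq_0: "s k = 0 \<Longrightarrow> e k = 0"
  using norm_e[of k] by simp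

lemma norm_sum_e: "finite I \<Longrightarrow> (norm (\<Sum>k\<in>I. c k *\<^sub>C e k))\<^sup>2 = (\<Sum>k\<in>I. (cmod (c k) * norm (e k))\<^sup>2)"
  by (rule norm_sum_orthogonal) (simp_all add: orthogonal)

lemma cinner_diff_proj:
  assumes "finite I" "j \<in> I"
  shows "cinner (x - proj I x) (e j) = 0"
proof -
  have "cinner (proj I x) (e j) = (\<Sum>k\<in>I. if k = j then cinner x (e j) else 0)"
    unfolding proj_def cinner_sum_left
    by (rule sum.cong) (auto simp: cinner_scaleC_left cinner_e_e e_eq_0)
  then show ?thesis using assms by (simp add: cinner_diff_left)
qed

lemma norm_proj:
  assumes "finite I"
  shows "(norm x)\<^sup>2 = (\<Sum>k\<in>I. (cmod (cinner x (e k)))\<^sup>2) + (norm (x - proj I x))\<^sup>2"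
proof -
  have "cinner (proj I x) (x - proj I x) = 0"
  proof -
    have "cinner (e k) (x - proj I x) = 0" if "k \<in> I" for k
      using cinner_diff_proj[OF assms that, of x] cinner_commute[of "e k" "x - proj I x"] by simp
    then have "cinner (\<Sum>k\<in>I. cinner x (e k) *\<^sub>C e k) (x - proj I x) = 0"
      unfolding cinner_sum_left by (simp add: cinner_scaleC_left)
    then show ?thesis by (simp add: proj_def)
  qed
  then have "inner (proj I x) (x - proj I x) = 0" by (simp flip: Re_cinner)
  then have "(norm (proj I x + (x - proj I x)))\<^sup>2 = (norm (proj I x))\<^sup>2 + (norm (x - proj I x))\<^sup>2"
    unfolding power2_norm_eq_inner inner_add_left inner_add_right
    by (simp add: inner_commute)
  moreover have "(norm (proj I x))\<^sup>2 = (\<Sum>k\<in>I. (cmod (cinner x (e k)))\<^sup>2)"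
    unfolding proj_def norm_sum_e[OF assms]
    by (rule sum.cong) (auto simp: norm_e e_eq_0)
  ultimately show ?thesis by simp
qed

lemma bessel: "finite I \<Longrightarrow> (\<Sum>k\<in>I. (cmod (cinner x (e k)))\<^sup>2) \<le> (norm x)\<^sup>2"
  using norm_proj[of I x] by simp

lemma norm_diff_proj_le: "finite I \<Longrightarrow> norm (x - proj I x) \<le> norm x"
  using norm_proj[of I x] by - (rule power2_le_imp_le, simp_all add: sum_nonneg)

lemma norm_R_diff_proj_le: "norm (R (x - proj {..<n} x)) \<le> s n * norm x"
proof -
  have "norm (R (x - proj {..<n} x)) \<le> s n * norm (x - proj {..<n} x)"
    by (rule norm_le) (simp add: cinner_diff_proj)
  also have "\<dots> \<le> s n * norm x"
    by (intro mult_left_mono norm_diff_proj_le s_nonneg) simp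
  finally show ?thesis .
qed

lemma R_diff_proj_tendsto: "(\<lambda>n. R (x - proj {..<n} x)) \<longlonglongrightarrow> 0"
proof (rule Lim_null_comparison)
  show "(\<lambda>n. s n * norm x) \<longlonglongrightarrow> 0" using tendsto_mult_right[OF s_tendsto_zero] by simp
qed (simp add: norm_R_diff_proj_le)

text \<open>
  An operator is determined by its values on the \<open>e k\<close> as soon as it is negligible on the
  remainders \<open>x - proj {..<n} x\<close>.  These remainders need not tend to zero, since \<open>R\<close> may have a kernel;
  only their images under the operators in question do.
\<close>

lemma eq_if_eq_on_e:
  assumes F: "bounded_clinear F" and G: "bounded_clinear G" and "\<And>k. F (e k) = G (e k)"
    and lim: "(\<lambda>n. F (x - proj {..<n} x)) \<longlonglongrightarrow> 0" "(\<lambda>n. G (x - proj {..<n} x)) \<longlonglongrightarrow> 0"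
  shows "F x = G x"
proof -
  have "F (proj I x) = G (proj I x)" for I
    unfolding proj_def by (simp add: bounded_clinearD(2,8)[OF F] bounded_clinearD(2,8)[OF G] assms(3))
  then have "F (x - proj {..<n} x) - G (x - proj {..<n} x) = F x - G x" for n
    by (simp add: bounded_clinearD(4)[OF F] bounded_clinearD(4)[OF G])
  with tendsto_diff[OF lim] show ?thesis by (simp add: LIMSEQ_const_iff)
qed

section \<open>Square roots of positive compact operators\<close>

text \<open>
  The root is \<open>S x = (\<Sum>k. sqrt (s k) \<langle>x, e k\<rangle> e k)\<close>.  The tail of the series from \<open>m\<close> on has squared norm at most
  \<open>s m * (norm x)\<^sup>2\<close> by Bessel's inequality, so \<open>s \<longlonglongrightarrow> 0\<close> yields convergence.
\<close>

lemma sqrt_exists: "\<exists>S. positive_op S \<and> S \<circ> S = R"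
proof -
  define p where "p n x = (\<Sum>k<n. (sqrt (s k) * cinner x (e k)) *\<^sub>C e k)" for n x
  have diff: "(norm (p n x - p m x))\<^sup>2 \<le> s m * (norm x)\<^sup>2" if "m \<le> n" for m n x
  proof -
    have "p n x - p m x = (\<Sum>k=m..<n. (sqrt (s k) * cinner x (e k)) *\<^sub>C e k)"
      unfolding p_def lessThan_atLeast0 by (rule sum_diff_nat_ivl) (use that in auto)
    then have "(norm (p n x - p m x))\<^sup>2 = (\<Sum>k=m..<n. (cmod (sqrt (s k) * cinner x (e k)) * norm (e k))\<^sup>2)"
      by (simp only: norm_sum_e finite_atLeastLessThan)
    also have "\<dots> \<le> (\<Sum>k=m..<n. s m * (cmod (cinner x (e k)))\<^sup>2)"
    proof (rule sum_mono)
      fix k assume "k \<in> {m..<n}"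
      then have "s k \<le> s m" using decseq_s unfolding decseq_def by simp
      moreover have "(cmod (sqrt (s k) * cinner x (e k)) * norm (e k))\<^sup>2 = s k * (cmod (cinner x (e k)))\<^sup>2"
        by (simp add: norm_mult power_mult_distrib s_nonneg norm_e)
      ultimately show "(cmod (sqrt (s k) * cinner x (e k)) * norm (e k))\<^sup>2 \<le> s m * (cmod (cinner x (e k)))\<^sup>2"
        by (simp add: mult_right_mono)
    qed
    also have "\<dots> = s m * (\<Sum>k=m..<n. (cmod (cinner x (e k)))\<^sup>2)" by (simp add: sum_distrib_left)
    also have "\<dots> \<le> s m * (norm x)\<^sup>2" by (intro mult_left_mono bessel s_nonneg) simp
    finally show ?thesis .
  qed
  have "Cauchy (\<lambda>n. p n x)" for x
  proof (rule metric_CauchyI)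
    fix \<epsilon> :: real assume "\<epsilon> > 0"
    have "(\<lambda>n. s n * (norm x)\<^sup>2) \<longlonglongrightarrow> 0" using tendsto_mult_right[OF s_tendsto_zero] by simp
    then have "\<forall>\<^sub>F n in sequentially. s n * (norm x)\<^sup>2 < \<epsilon>\<^sup>2"
      by (rule order_tendstoD) (use \<open>\<epsilon> > 0\<close> in simp)
    then obtain N where N: "\<And>n. n \<ge> N \<Longrightarrow> s n * (norm x)\<^sup>2 < \<epsilon>\<^sup>2"
      unfolding eventually_sequentially by blast
    have "dist (p m x) (p n x) < \<epsilon>" if "N \<le> m" "m \<le> n" for m n
    proof -
      have "(norm (p n x - p m x))\<^sup>2 < \<epsilon>\<^sup>2" using diff[OF that(2)] N[OF that(1)] by (rule le_less_trans)
      then have "norm (p n x - p m x) < \<epsilon>" by (rule power2_less_imp_less) (use \<open>\<epsilon> > 0\<close> in simp)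
      then show ?thesis by (simp add: dist_norm norm_minus_commute)
    qed
    then have "dist (p m x) (p n x) < \<epsilon>" if "m \<ge> N" "n \<ge> N" for m n
      using that by (metis dist_commute nle_le)
    then show "\<exists>M. \<forall>m\<ge>M. \<forall>n\<ge>M. dist (p m x) (p n x) < \<epsilon>" by blast
  qed
  then have "\<exists>y. (\<lambda>n. p n x) \<longlonglongrightarrow> y" for x using Cauchy_convergent_iff convergent_def by blast
  then obtain S where S: "\<And>x. (\<lambda>n. p n x) \<longlonglongrightarrow> S x" by metis
  have S_clinear: "bounded_clinear S"
  proof (rule bounded_clinear_intro[where K = "sqrt (s 0)"])
    fix x y c
    have "p n (x + y) = p n x + p n y" for n
      unfolding p_def by (simp add: cinner_add_left scaleC_add_left distrib_left sum.distrib)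
    then have "(\<lambda>n. p n (x + y)) \<longlonglongrightarrow> S x + S y" using tendsto_add[OF S S] by simp
    then show "S (x + y) = S x + S y" using S LIMSEQ_unique by blast
    have "p n (c *\<^sub>C x) = c *\<^sub>C p n x" for n
      unfolding p_def by (simp add: cinner_scaleC_left complex_vector.scale_sum_right scaleC_scaleC mult_ac)
    then have "(\<lambda>n. p n (c *\<^sub>C x)) \<longlonglongrightarrow> c *\<^sub>C S x" using tendsto_scaleC[OF S] by simp
    then show "S (c *\<^sub>C x) = c *\<^sub>C S x" using S LIMSEQ_unique by blast
    have "norm (p n x) \<le> norm x * sqrt (s 0)" for n
    proof (rule power2_le_imp_le)
      show "(norm (p n x))\<^sup>2 \<le> (norm x * sqrt (s 0))\<^sup>2"
        using diff[of 0 n x] by (simp add: p_def power_mult_distrib s_nonneg mult.commute)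
    qed (simp add: s_nonneg)
    then show "norm (S x) \<le> norm x * sqrt (s 0)"
      by (intro LIMSEQ_le_const2[OF tendsto_norm[OF S]]) blast
  qed
  moreover have "cinner (S x) x \<in> \<real>\<^sub>\<ge>\<^sub>0" for x
  proof (rule closed_sequentially[OF closed_nonneg_Reals_complex])
    show "(\<lambda>n. cinner (p n x) x) \<longlonglongrightarrow> cinner (S x) x" by (rule tendsto_cinner_left[OF S])
    have "cinner (p n x) x = of_real (\<Sum>k<n. sqrt (s k) * (cmod (cinner x (e k)))\<^sup>2)" for n
    proof -
      have "cinner ((sqrt (s k) * cinner x (e k)) *\<^sub>C e k) x = of_real (sqrt (s k) * (cmod (cinner x (e k)))\<^sup>2)" for k
        using cinner_commute[of "e k" x]
        by (simp add: cinner_scaleC_left complex_norm_square del: of_real_power)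
      then show ?thesis unfolding p_def cinner_sum_left by simp
    qed
    then show "cinner (p n x) x \<in> \<real>\<^sub>\<ge>\<^sub>0" for n
      by (simp add: sum_nonneg s_nonneg del: of_real_sum)
  qed
  ultimately have "positive_op S" unfolding positive_op_def by blast
  have S_e: "S (e k) = sqrt (s k) *\<^sub>R e k" for k
  proof -
    have "p n (e k) = sqrt (s k) *\<^sub>R e k" if "n > k" for n
    proof -
      have "p n (e k) = (\<Sum>i<n. if i = k then sqrt (s k) *\<^sub>R e k else 0)"
        unfolding p_def by (rule sum.cong) (auto simp: cinner_e_e e_eq_0 scaleC_of_real)
      then show ?thesis using that by simp
    qed
    then have "(\<lambda>n. p n (e k)) \<longlonglongrightarrow> sqrt (s k) *\<^sub>R e k"
      by (intro tendsto_eventually eventually_sequentiallyI[of "Suc k"]) simp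
    then show ?thesis using S LIMSEQ_unique by blast
  qed
  have "S (p n x) = R x - R (x - proj {..<n} x)" for n x
  proof -
    have "S (p n x) = (\<Sum>k<n. cinner x (e k) *\<^sub>C s k *\<^sub>R e k)"
      unfolding p_def
      by (simp add: bounded_clinearD(2,8)[OF S_clinear] S_e scaleC_scaleC s_nonneg mult_ac
          flip: scaleC_of_real of_real_mult)
    also have "\<dots> = R (proj {..<n} x)"
      unfolding proj_def by (simp add: bounded_clinearD(2,8)[OF R_clinear] eigen)
    finally show ?thesis by (simp add: bounded_clinearD(4)[OF R_clinear])
  qed
  then have "(\<lambda>n. S (p n x)) \<longlonglongrightarrow> R x" for x
    using tendsto_diff[OF tendsto_const R_diff_proj_tendsto, of "R x" x] by simp
  then have "S (S x) = R x" for x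
    using bounded_clinearD(9)[OF S_clinear S] LIMSEQ_unique by blast
  then have "S \<circ> S = R" by auto
  with \<open>positive_op S\<close> show ?thesis by blast
qed

lemma sqrt_eigenvector:
  assumes "positive_op S" "S \<circ> S = R" "R v = s k *\<^sub>R v" "s k \<noteq> 0"
  shows "S v = sqrt (s k) *\<^sub>R v"
proof (rule positive_sqrt_eigenvector[OF assms(1)])
  show "S (S v) = (sqrt (s k) * sqrt (s k)) *\<^sub>R v"
    using assms(3) s_nonneg[of k] by (simp flip: assms(2))
  show "sqrt (s k) > 0" using assms(4) s_nonneg[of k] by simp
qed

text \<open>
  For \<open>z = x - proj {..<n} x\<close> one has \<open>(norm (S (L z)))\<^sup>2 = \<langle>R (L z), L z\<rangle> = \<langle>L (R z), L z\<rangle>\<close>, which is controlled by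
  \<open>norm (R z) \<le> s n * norm x\<close>.
\<close>

lemma sqrt_diff_proj_tendsto:
  assumes S: "positive_op S" "S \<circ> S = R" and L: "bounded_clinear L" "L \<circ> R = R \<circ> L"
  shows "(\<lambda>n. S (L (x - proj {..<n} x))) \<longlonglongrightarrow> 0"
proof -
  obtain K where K: "K > 0" "\<And>x. norm (L x) \<le> norm x * K"
    using bounded_linear.pos_bounded[OF bounded_clinearD(1)[OF L(1)]] by blast
  have "norm (S (L (x - proj {..<n} x))) \<le> sqrt (s n * K\<^sup>2 * (norm x)\<^sup>2)" for n
  proof (rule real_le_rsqrt)
    define z where "z = x - proj {..<n} x"
    have "(norm (S (L z)))\<^sup>2 = inner (R (L z)) (L z)"
      unfolding power2_norm_eq_inner positive_opD(4)[OF S(1)] S(2)[symmetric] comp_def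
      by (simp add: inner_commute)
    also have "R (L z) = L (R z)" using L(2) by (metis comp_apply)
    also have "inner (L (R z)) (L z) \<le> norm (L (R z)) * norm (L z)" by (rule norm_cauchy_schwarz)
    also have "\<dots> \<le> ((s n * norm x) * K) * (norm x * K)"
    proof (intro mult_mono)
      show "norm (L (R z)) \<le> s n * norm x * K"
        using K(2)[of "R z"] norm_R_diff_proj_le[of x n] K(1) unfolding z_def
        by (meson order_trans mult_right_mono less_imp_le)
      show "norm (L z) \<le> norm x * K"
        using K(2)[of z] norm_diff_proj_le[of "{..<n}" x] K(1) unfolding z_def
        by (meson finite_lessThan order_trans mult_right_mono less_imp_le)
    qed (use K s_nonneg in auto)
    finally show "(norm (S (L (x - proj {..<n} x))))\<^sup>2 \<le> s n * K\<^sup>2 * (norm x)\<^sup>2"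
      unfolding z_def by (simp add: power2_eq_square mult_ac)
  qed
  moreover have "(\<lambda>n. sqrt (s n * K\<^sup>2 * (norm x)\<^sup>2)) \<longlonglongrightarrow> sqrt (0 * K\<^sup>2 * (norm x)\<^sup>2)"
    by (intro tendsto_intros s_tendsto_zero)
  ultimately show ?thesis by - (rule Lim_null_comparison[OF always_eventually], auto)
qed

text \<open>
  On \<open>e k\<close> the two products agree, because \<open>L (e k)\<close> is again an eigenvector of \<open>R\<close> for \<open>s k\<close>, hence of \<open>S\<close> for
  \<open>sqrt (s k)\<close>.
\<close>

lemma sqrt_commute:
  assumes S: "positive_op S" "S \<circ> S = R" and L: "bounded_clinear L" "L \<circ> R = R \<circ> L"
  shows "S \<circ> L = L \<circ> S"
proof
  fix x
  note S_clinear = positive_opD(1)[OF S(1)]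
  have LR: "L (R y) = R (L y)" for y using L(2) by (metis comp_apply)
  have id: "bounded_clinear (\<lambda>x. x)" by (simp add: bounded_clinear_def)
  show "(S \<circ> L) x = (L \<circ> S) x"
  proof (rule eq_if_eq_on_e[of "S \<circ> L" "L \<circ> S"])
    show "bounded_clinear (S \<circ> L)" "bounded_clinear (L \<circ> S)"
      by (intro bounded_clinear_compose S_clinear L)+
    show "(S \<circ> L) (e k) = (L \<circ> S) (e k)" for k
    proof (cases "s k = 0")
      case False
      have "S (L (e k)) = sqrt (s k) *\<^sub>R L (e k)" "S (e k) = sqrt (s k) *\<^sub>R e k"
        using sqrt_eigenvector[OF S _ False] eigen[of k] LR[of "e k"]
        by (simp_all add: bounded_clinearD(5)[OF L(1)])
      then show ?thesis by (simp add: bounded_clinearD(5)[OF L(1)])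
    qed (simp add: e_eq_0 bounded_clinearD[OF S_clinear] bounded_clinearD[OF L(1)])
    show "(\<lambda>n. (S \<circ> L) (x - proj {..<n} x)) \<longlonglongrightarrow> 0"
      using sqrt_diff_proj_tendsto[OF S L] by simp
    have "(\<lambda>n. S (x - proj {..<n} x)) \<longlonglongrightarrow> 0"
      using sqrt_diff_proj_tendsto[OF S id] by (simp add: comp_def)
    then show "(\<lambda>n. (L \<circ> S) (x - proj {..<n} x)) \<longlonglongrightarrow> 0"
      using bounded_clinearD(9)[OF L(1)] bounded_clinearD(6)[OF L(1)] by fastforce
  qed
qed

lemma sqrt_unique:
  assumes S: "positive_op S" "S \<circ> S = R" and S': "positive_op S'" "S' \<circ> S' = R"
  shows "S = S'"
proof
  fix x
  have id: "bounded_clinear (\<lambda>x. x)" by (simp add: bounded_clinear_def)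
  show "S x = S' x"
  proof (rule eq_if_eq_on_e[of S S'])
    show "bounded_clinear S" "bounded_clinear S'" using S S' by (simp_all add: positive_opD)
    then show "S (e k) = S' (e k)" for k
      using sqrt_eigenvector[OF S eigen, of k] sqrt_eigenvector[OF S' eigen, of k]
      by (cases "s k = 0") (simp_all add: e_eq_0 bounded_clinearD)
    show "(\<lambda>n. S (x - proj {..<n} x)) \<longlonglongrightarrow> 0" "(\<lambda>n. S' (x - proj {..<n} x)) \<longlonglongrightarrow> 0"
      using sqrt_diff_proj_tendsto[OF S id] sqrt_diff_proj_tendsto[OF S' id] by (simp_all add: comp_def)
  qed
qed

end

section \<open>Absolute values\<close>

lemma sqrt_op:
  assumes "positive_op R" "seq_compact_op R"
  shows "positive_op (sqrt_op R)" "sqrt_op R \<circ> sqrt_op R = R"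
    and sqrt_op_eqI: "\<And>S. positive_op S \<Longrightarrow> S \<circ> S = R \<Longrightarrow> sqrt_op R = S"
    and sqrt_op_commute: "\<And>L. bounded_clinear L \<Longrightarrow> L \<circ> R = R \<circ> L \<Longrightarrow> sqrt_op R \<circ> L = L \<circ> sqrt_op R"
proof -
  obtain e s where "schmidt_system R e s" using schmidt_system_exists[OF assms] by blast
  then interpret schmidt_system R e s .
  show eqI: "sqrt_op R = S" if "positive_op S" "S \<circ> S = R" for S
    unfolding sqrt_op_def using that sqrt_unique by (intro the_equality) auto
  then show *: "positive_op (sqrt_op R)" "sqrt_op R \<circ> sqrt_op R = R"
    using sqrt_exists by auto
  show "sqrt_op R \<circ> L = L \<circ> sqrt_op R" if "bounded_clinear L" "L \<circ> R = R \<circ> L" for L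
    by (rule sqrt_commute[OF * that])
qed

lemma positive_cadjoint_comp_self:
  assumes X: "bounded_clinear X"
  shows "positive_op (cadjoint X \<circ> X)"
proof (rule positive_op_intro)
  show "bounded_clinear (cadjoint X \<circ> X)"
    by (rule bounded_clinear_compose[OF bounded_clinear_cadjoint[OF X] X])
  show "cinner ((cadjoint X \<circ> X) x) y = cinner x ((cadjoint X \<circ> X) y)" for x y
    by (simp flip: cinner_cadjoint[OF X])
  have "cinner (cadjoint X (X x)) x = cinner (X x) (X x)" for x
    by (simp flip: cinner_cadjoint(2)[OF X])
  then show "0 \<le> inner ((cadjoint X \<circ> X) x) x" for x by (simp flip: Re_cinner add: cinner_self)
qed

lemma seq_compact_cadjoint_comp_self:
  assumes X: "bounded_clinear X" "seq_compact_op X"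
  shows "seq_compact_op (cadjoint X \<circ> X)"
proof -
  have clin: "bounded_clinear (cadjoint X)" by (rule bounded_clinear_cadjoint[OF X(1)])
  obtain K where "\<And>x. norm (cadjoint X x) \<le> norm x * K"
    using bounded_linear.bounded[OF bounded_clinearD(1)[OF clin]] by blast
  then have "norm ((cadjoint X \<circ> X) x) \<le> K * norm (X x)" for x by (simp add: mult.commute)
  then show ?thesis
    by (rule seq_compact_op_dominated[OF X(2,1) bounded_clinear_compose[OF clin X(1)]])
qed

lemma abs_op:
  assumes X: "bounded_clinear X" "seq_compact_op X"
  shows "positive_op (abs_op X)" "abs_op X \<circ> abs_op X = cadjoint X \<circ> X"
    "norm (abs_op X x) = norm (X x)" "seq_compact_op (abs_op X)"
proof -
  show P: "positive_op (abs_op X)" and sq: "abs_op X \<circ> abs_op X = cadjoint X \<circ> X"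
    unfolding abs_op_def by (rule sqrt_op(1,2)[OF positive_cadjoint_comp_self[OF X(1)] seq_compact_cadjoint_comp_self[OF X]])+
  show norm: "norm (abs_op X x) = norm (X x)" for x
  proof -
    have "inner (abs_op X x) (abs_op X x) = inner (abs_op X (abs_op X x)) x"
      using positive_opD(4)[OF P, of "abs_op X x" x] by simp
    also have "\<dots> = inner (cadjoint X (X x)) x" using fun_cong[OF sq, of x] by simp
    also have "\<dots> = inner (X x) (X x)"
      using cinner_cadjoint(2)[OF X(1), of "X x" x] by (simp flip: Re_cinner)
    finally show ?thesis by (simp add: norm_eq_sqrt_inner)
  qed
  show "seq_compact_op (abs_op X)"
    by (rule seq_compact_op_dominated[OF X(2,1) positive_opD(1)[OF P], of 1]) (simp add: norm)
qed

text \<open>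
  The square root \<open>S\<close> of \<open>P\<close> commutes with \<open>Q\<close>, so that \<open>\<langle>P x, Q x\<rangle> = \<langle>Q (S x), S x\<rangle>\<close>.
\<close>

lemma inner_commuting_positive:
  assumes P: "positive_op P" "seq_compact_op P" and Q: "positive_op Q" and comm: "P \<circ> Q = Q \<circ> P"
  shows "0 \<le> inner (P x) (Q x)"
proof -
  note S = sqrt_op(1,2)[OF P]
  have comm': "sqrt_op P \<circ> Q = Q \<circ> sqrt_op P"
    by (rule sqrt_op_commute[OF P]) (simp_all add: positive_opD[OF Q] comm)
  have SQ: "sqrt_op P (Q y) = Q (sqrt_op P y)" for y using fun_cong[OF comm', of y] by simp
  have "P x = sqrt_op P (sqrt_op P x)" using fun_cong[OF S(2), of x] by simp
  then have "inner (P x) (Q x) = inner (Q (sqrt_op P x)) (sqrt_op P x)"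
    using positive_opD(4)[OF S(1), of "sqrt_op P x" "Q x"]
      positive_opD(4)[OF Q, of "sqrt_op P x" "sqrt_op P x"] by (simp add: SQ)
  then show ?thesis using positive_opD(2)[OF Q] by simp
qed

section \<open>Singular values\<close>

text \<open>
  The vectors \<open>e n\<close> with \<open>s n = \<mu>\<close> are a basis of the eigenspace of \<open>\<mu> > 0\<close>.  They span it because an eigenvector \<open>y\<close>
  orthogonal to them is orthogonal to every \<open>e k\<close> (eigenvectors for distinct eigenvalues are orthogonal), whence
  \<open>norm (R y) \<le> s n * norm y\<close> for all \<open>n\<close> and so \<open>R y = 0\<close>.
\<close>

lemma schmidt_singular_value_seq:
  assumes "schmidt_system (abs_op X) e s"
  shows "singular_value_seq X s"
proof -
  define R where "R = abs_op X"
  interpret schmidt_system R e s using assms unfolding R_def .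
  note R' = bounded_clinearD[OF R_clinear]
  have "finite {n. s n = \<mu>} \<and>
      card {n. s n = \<mu>} = complex_vector.dim (eigenspace R (complex_of_real \<mu>))" if "\<mu> > 0" for \<mu>
  proof -
    define N where "N = {n. s n = \<mu>}"
    define E where "E = eigenspace R (complex_of_real \<mu>)"
    have E: "x \<in> E \<longleftrightarrow> R x = \<mu> *\<^sub>R x" for x
      unfolding E_def eigenspace_def by (simp add: scaleC_of_real)
    have "\<forall>\<^sub>F n in sequentially. s n < \<mu>" by (rule order_tendstoD(2)[OF s_tendsto_zero that])
    then obtain n0 where n0: "\<And>n. n \<ge> n0 \<Longrightarrow> s n < \<mu>" unfolding eventually_sequentially by blast
    have "n < n0" if "n \<in> N" for n using n0[of n] that unfolding N_def by (cases "n < n0") auto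
    then have "N \<subseteq> {..<n0}" by blast
    then have fin: "finite N" using finite_subset by blast
    have inj: "inj_on e N"
    proof (rule inj_onI)
      fix m n assume "m \<in> N" "n \<in> N" "e m = e n"
      then show "m = n" using cinner_e_e[of m n] cinner_e_e[of n n] that unfolding N_def by (auto split: if_splits)
    qed
    have indep: "complex_vector.independent (e ` N)"
    proof (rule complex_vector.independent_if_scalars_zero)
      show "finite (e ` N)" using fin by simp
      fix f x assume sum: "(\<Sum>x\<in>e ` N. f x *\<^sub>C x) = 0" and "x \<in> e ` N"
      then obtain n where n: "n \<in> N" "x = e n" by blast
      have "0 = cinner (\<Sum>k\<in>N. f (e k) *\<^sub>C e k) (e n)"
        using sum by (simp add: sum.reindex[OF inj])
      also have "\<dots> = (\<Sum>k\<in>N. if k = n then f (e n) else 0)"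
        unfolding cinner_sum_left using n(1) that
        by (intro sum.cong) (auto simp: cinner_scaleC_left cinner_e_e N_def)
      finally show "f x = 0" using fin n by simp
    qed
    have subspace: "complex_vector.subspace E"
      by (rule complex_vector.subspaceI)
        (simp_all add: E R' scaleC_add_right scaleC_scaleC mult.commute flip: scaleC_of_real)
    have "e ` N \<subseteq> E" unfolding N_def using E eigen by auto
    moreover have "E \<subseteq> complex_vector.span (e ` N)"
    proof
      fix x assume "x \<in> E"
      have pE: "proj N x \<in> E"
        unfolding proj_def using \<open>e ` N \<subseteq> E\<close>
        by (intro complex_vector.subspace_sum[OF subspace] complex_vector.subspace_scale[OF subspace]) blast
      define y where "y = x - proj N x"
      have yE: "y \<in> E" unfolding y_def by (rule complex_vector.subspace_diff[OF subspace \<open>x \<in> E\<close> pE])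
      have orth: "cinner y (e k) = 0" for k
      proof (cases "k \<in> N")
        case True
        then show ?thesis unfolding y_def by (rule cinner_diff_proj[OF fin])
      next
        case False
        have "\<mu> * cinner y (e k) = cinner (R y) (e k)" using yE by (simp add: E cinner_scaleR_left)
        also have "\<dots> = s k * cinner y (e k)"
          by (simp add: positive_opD(3)[OF positive] eigen cinner_scaleR_right)
        finally show ?thesis using False unfolding N_def by simp
      qed
      have "norm (R y) \<le> s n * norm y" for n by (rule norm_le) (rule orth)
      moreover have "(\<lambda>n. s n * norm y) \<longlonglongrightarrow> 0" using tendsto_mult_right[OF s_tendsto_zero] by simp
      ultimately have "norm (R y) \<le> 0" by (intro LIMSEQ_le_const) auto
      then have "y = 0" using yE that by (simp add: E)
      then have "x = proj N x" unfolding y_def by simp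
      also have "\<dots> \<in> complex_vector.span (e ` N)"
        unfolding proj_def by (intro complex_vector.span_sum complex_vector.span_scale complex_vector.span_base) blast
      finally show "x \<in> complex_vector.span (e ` N)" .
    qed
    ultimately have "complex_vector.dim E = card (e ` N)"
      using complex_vector.dim_unique[OF _ _ indep] by blast
    then show ?thesis using fin card_image[OF inj] unfolding N_def E_def by simp
  qed
  then show ?thesis
    unfolding singular_value_seq_def R_def[symmetric] using decseq_s s_nonneg by blast
qed

text \<open>
  Gaussian elimination: the equation \<open>j\<close> is used to eliminate an unknown \<open>p\<close> with nonzero coefficient.
\<close>

lemma homogeneous_system_solution:
  fixes f :: "'i \<Rightarrow> 'j \<Rightarrow> 'f::field"
  assumes "finite J" "finite I" "card J < card I"
  shows "\<exists>a. (\<exists>k\<in>I. a k \<noteq> 0) \<and> (\<forall>j\<in>J. (\<Sum>k\<in>I. a k * f k j) = 0)"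
  using assms
proof (induction J arbitrary: I f rule: finite_induct)
  case empty
  then have "I \<noteq> {}" by auto
  then show ?case by (intro exI[of _ "\<lambda>_. 1"]) auto
next
  case (insert j J)
  show ?case
  proof (cases "\<forall>k\<in>I. f k j = 0")
    case True
    have "card J < card I" using insert.prems insert.hyps by simp
    with insert.IH[of I f] insert.prems(1) obtain a
      where "\<exists>k\<in>I. a k \<noteq> 0" "\<forall>j\<in>J. (\<Sum>k\<in>I. a k * f k j) = 0" by blast
    then show ?thesis using True by (intro exI[of _ a]) simp
  next
    case False
    then obtain p where p: "p \<in> I" "f p j \<noteq> 0" by blast
    define I' where "I' = I - {p}"
    define f' where "f' k i = f k i - f k j / f p j * f p i" for k i
    have I': "finite I'" "card J < card I'" "p \<notin> I'" "I = insert p I'"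
      using insert.prems insert.hyps p(1) unfolding I'_def by auto
    with insert.IH[of I' f'] obtain a
      where a: "\<exists>k\<in>I'. a k \<noteq> 0" "\<forall>i\<in>J. (\<Sum>k\<in>I'. a k * f' k i) = 0" by blast
    define b where "b = a(p := - (\<Sum>k\<in>I'. a k * f k j / f p j))"
    have b: "(\<Sum>k\<in>I. b k * f k i) = (\<Sum>k\<in>I'. a k * f' k i)" for i
    proof -
      have "(\<Sum>k\<in>I'. b k * f k i) = (\<Sum>k\<in>I'. a k * f k i)"
        by (rule sum.cong) (use I'(3) in \<open>auto simp: b_def\<close>)
      then have "(\<Sum>k\<in>I. b k * f k i) = (\<Sum>k\<in>I'. a k * f k i) - (\<Sum>k\<in>I'. a k * f k j / f p j) * f p i"
        unfolding I'(4) using I'(1,3) by (simp add: b_def)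
      also have "\<dots> = (\<Sum>k\<in>I'. a k * f' k i)"
        unfolding f'_def by (simp add: sum_distrib_right right_diff_distrib sum_subtractf mult.assoc)
      finally show ?thesis .
    qed
    have "f' k j = 0" for k unfolding f'_def using p(2) by simp
    then have "\<forall>i\<in>insert j J. (\<Sum>k\<in>I. b k * f k i) = 0" using a(2) b by simp
    moreover have "\<exists>k\<in>I. b k \<noteq> 0" using a(1) I'(3,4) unfolding b_def by auto
    ultimately show ?thesis by blast
  qed
qed

text \<open>
  This is the min-max argument.  Some nonzero \<open>x\<close> in the span of \<open>e 0, \<dots>, e n\<close> is orthogonal to the \<open>n\<close> vectors
  \<open>e' 0, \<dots>, e' (n - 1)\<close>, and for it
  \<open>s n * norm x \<le> norm (R x) \<le> c * norm (R' x) \<le> c * s' n * norm x\<close>.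
\<close>

lemma schmidt_system_mono:
  assumes R: "schmidt_system R e s" and R': "schmidt_system R' e' s'"
    and le: "\<And>x. norm (R x) \<le> c * norm (R' x)" and "0 \<le> c"
  shows "s n \<le> c * s' n"
proof (cases "s n = 0")
  case True
  then show ?thesis using \<open>0 \<le> c\<close> schmidt_system.s_nonneg[OF R'] by simp
next
  case False
  interpret R: schmidt_system R e s by fact
  interpret R': schmidt_system R' e' s' by fact
  have s: "s n > 0" using False R.s_nonneg[of n] by simp
  have s_k: "s n \<le> s k" if "k \<le> n" for k using R.decseq_s that unfolding decseq_def by blast
  then have norm_e: "norm (e k) = 1" if "k \<le> n" for k using R.norm_e[of k] s that by fastforce
  obtain a where a: "\<exists>k\<in>{..n}. a k \<noteq> 0" "\<forall>j\<in>{..<n}. (\<Sum>k\<le>n. a k * cinner (e k) (e' j)) = 0"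
    using homogeneous_system_solution[of "{..<n}" "{..n}" "\<lambda>k j. cinner (e k) (e' j)"] by auto
  define x where "x = (\<Sum>k\<le>n. a k *\<^sub>C e k)"
  have norm_x: "(norm x)\<^sup>2 = (\<Sum>k\<le>n. (cmod (a k))\<^sup>2)"
    unfolding x_def R.norm_sum_e[OF finite_atMost] by (simp add: norm_e)
  moreover have "(\<Sum>k\<le>n. (cmod (a k))\<^sup>2) > 0"
    using a(1) by (auto intro!: sum_pos2)
  ultimately have "norm x > 0" by (metis zero_less_norm_iff norm_zero power_zero_numeral less_irrefl)
  have "R x = (\<Sum>k\<le>n. (of_real (s k) * a k) *\<^sub>C e k)"
    unfolding x_def
    by (simp add: bounded_clinearD(2,8)[OF R.R_clinear] R.eigen scaleC_scaleC mult.commute flip: scaleC_of_real)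
  then have "(norm (R x))\<^sup>2 = (\<Sum>k\<le>n. (s k)\<^sup>2 * (cmod (a k))\<^sup>2)"
    by (simp add: R.norm_sum_e norm_e norm_mult power_mult_distrib)
  moreover have "(s n * norm x)\<^sup>2 \<le> (\<Sum>k\<le>n. (s k)\<^sup>2 * (cmod (a k))\<^sup>2)"
    unfolding power_mult_distrib norm_x sum_distrib_left
    using s s_k by (intro sum_mono mult_right_mono power_mono) auto
  ultimately have "s n * norm x \<le> norm (R x)"
    by (metis norm_ge_zero power2_le_imp_le)
  also have "\<dots> \<le> c * norm (R' x)" by (rule le)
  also have "\<dots> \<le> c * (s' n * norm x)"
  proof (intro mult_left_mono R'.norm_le)
    show "cinner x (e' k) = 0" if "k < n" for k
      using a(2) that unfolding x_def by (simp add: cinner_sum_left cinner_scaleC_left)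
  qed fact
  finally show ?thesis using \<open>norm x > 0\<close> by simp
qed

lemma singular_value_mono:
  assumes X: "bounded_clinear X" "seq_compact_op X" and Y: "bounded_clinear Y" "seq_compact_op Y"
    and le: "\<And>x. norm (X x) \<le> c * norm (Y x)" and "0 \<le> c"
  shows "singular_value X j \<le> c * singular_value Y j"
proof -
  obtain e s where s: "schmidt_system (abs_op X) e s"
    using schmidt_system_exists[OF abs_op(1,4)[OF X]] by blast
  obtain e' s' where s': "schmidt_system (abs_op Y) e' s'"
    using schmidt_system_exists[OF abs_op(1,4)[OF Y]] by blast
  have eq: "singular_value Z j = t (j - 1)" if "singular_value_seq Z t" for Z :: "'a \<Rightarrow> 'a" and t
    unfolding singular_value_def using that singular_value_seq_unique by (metis the_equality)
  have "s (j - 1) \<le> c * s' (j - 1)"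
    by (rule schmidt_system_mono[OF s s']) (simp_all add: abs_op(3)[OF X] abs_op(3)[OF Y] le \<open>0 \<le> c\<close>)
  then show ?thesis
    using eq[OF schmidt_singular_value_seq[OF s]] eq[OF schmidt_singular_value_seq[OF s']] by simp
qed

section \<open>Conjugations\<close>

lemma conjugationD:
  assumes "conjugation C"
  shows "C (x + y) = C x + C y" "C (c *\<^sub>C x) = cnj c *\<^sub>C C x" "C (C x) = x"
    "cinner (C x) y = cinner (C y) x" "cinner x (C y) = cinner y (C x)" "norm (C x) = norm x"
proof -
  show C: "C (x + y) = C x + C y" "C (c *\<^sub>C x) = cnj c *\<^sub>C C x" "C (C x) = x" for x
    using assms unfolding conjugation_def antilinear_def by (auto dest: fun_cong)
  have inner: "cinner (C x) (C y) = cinner y x" for x y using assms unfolding conjugation_def by blast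
  show "cinner (C x) y = cinner (C y) x" using inner[of x "C y"] C(3) by simp
  show "cinner x (C y) = cinner y (C x)" using inner[of "C x" y] C(3) by simp
  show "norm (C x) = norm x" using inner[of x x] unfolding cinner_self of_real_eq_iff by simp
qed

lemma conjugate_op:
  assumes C: "conjugation C" and T: "bounded_clinear T"
  shows "bounded_clinear (\<lambda>x. C (T (C x)))" "cadjoint (\<lambda>x. C (T (C x))) = (\<lambda>x. C (cadjoint T (C x)))"
proof -
  note C' = conjugationD[OF C]
  obtain K where K: "\<And>x. norm (T x) \<le> norm x * K"
    using bounded_linear.bounded[OF bounded_clinearD(1)[OF T]] by blast
  show "bounded_clinear (\<lambda>x. C (T (C x)))"
  proof (rule bounded_clinear_intro[where K = K])
    show "norm (C (T (C x))) \<le> norm x * K" for x using K[of "C x"] by (simp add: C'(6))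
  qed (simp_all add: C'(1,2) bounded_clinearD(2,3)[OF T])
  show "cadjoint (\<lambda>x. C (T (C x))) = (\<lambda>x. C (cadjoint T (C x)))"
  proof (rule cadjoint_eqI)
    fix x y
    have "cinner (C (T (C x))) y = cinner (C y) (T (C x))" by (rule C'(4))
    also have "\<dots> = cinner (cadjoint T (C y)) (C x)" by (rule cinner_cadjoint(2)[OF T])
    also have "\<dots> = cinner x (C (cadjoint T (C y)))" by (rule C'(5))
    finally show "cinner (C (T (C x))) y = cinner x (C (cadjoint T (C y)))" .
  qed
qed

text \<open>
  Squaring \<open>C |T| C = |T\<^sup>*|\<close>, where \<open>C C\<close> cancels in the middle.  For this the square root of \<open>T T\<^sup>*\<close> must
  exist, which the compactness of \<open>T\<close> ensures.
\<close>

lemma C_normal_cadjoint: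
  assumes "conjugation C" "C_normal C T" and T: "seq_compact_op T"
  shows "C (cadjoint T (T (C x))) = T (cadjoint T x)"
proof -
  have T_clin: "bounded_clinear T" and eq: "C \<circ> abs_op T \<circ> C = abs_op (cadjoint T)"
    using assms(2) unfolding C_normal_def by auto
  note T'_clin = bounded_clinear_cadjoint[OF T_clin]
  have TT: "abs_op T (abs_op T y) = cadjoint T (T y)" for y
    using fun_cong[OF abs_op(2)[OF T_clin T], of y] by simp
  have "seq_compact_op (T \<circ> cadjoint T)" by (rule seq_compact_op_compose[OF T T_clin T'_clin])
  moreover have "positive_op (T \<circ> cadjoint T)"
    using positive_cadjoint_comp_self[OF T'_clin] cadjoint_cadjoint[OF T_clin] by simp
  ultimately have sq: "abs_op (cadjoint T) \<circ> abs_op (cadjoint T) = T \<circ> cadjoint T"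
    unfolding abs_op_def cadjoint_cadjoint[OF T_clin] by (intro sqrt_op(2))
  have "T (cadjoint T x) = C (abs_op T (C (C (abs_op T (C x)))))"
    using fun_cong[OF sq, of x] by (simp flip: eq)
  then show ?thesis by (simp add: conjugationD(3)[OF assms(1)] TT)
qed

section \<open>The Cartesian decomposition\<close>

locale C_normal_compact =
  fixes C T :: "'a::complex_hilbert \<Rightarrow> 'a"
  assumes conj: "conjugation C" and T_compact: "seq_compact_op T" and T_normal: "C_normal C T"
begin

abbreviation "T' \<equiv> cadjoint T"
definition "D = (\<lambda>x. C (T' (C x)))"
definition "D' = (\<lambda>x. C (T (C x)))"

lemma T: "bounded_clinear T" "bounded_clinear T'"
  using T_normal bounded_clinear_cadjoint unfolding C_normal_def by auto

lemma D: "bounded_clinear D" "bounded_clinear D'" "cadjoint D = D'"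
  using conjugate_op[OF conj] T cadjoint_cadjoint[OF T(1)] unfolding D_def D'_def by auto

lemma D'_D: "D' (D x) = T' (T x)" and D_D': "D (D' x) = T (T' x)"
proof -
  note CC = conjugationD(3)[OF conj]
  note normal = C_normal_cadjoint[OF conj T_normal T_compact]
  show "D (D' x) = T (T' x)" unfolding D_def D'_def by (simp add: CC normal)
  show "D' (D x) = T' (T x)" unfolding D_def D'_def by (simp add: CC flip: normal)
qed

lemma norm_D: "norm (D x) = norm (T x)"
proof -
  have "cinner (D x) (D x) = cinner (T x) (T x)"
    by (simp add: cinner_cadjoint(2)[OF D(1)] cinner_cadjoint(2)[OF T(1)] D(3) D'_D)
  then show ?thesis unfolding cinner_self of_real_eq_iff by simp
qed

abbreviation "A \<equiv> cartesian_A C T"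
abbreviation "B \<equiv> cartesian_B C T"

lemma A_eq: "A = (\<lambda>x. (1/2) *\<^sub>C (T x + D x))" and B_eq: "B = (\<lambda>x. (1 / (2 * \<i>)) *\<^sub>C (T x - D x))"
  unfolding cartesian_A_def cartesian_B_def D_def by auto

lemma norm_A_B: "(norm (A x))\<^sup>2 + (norm (B x))\<^sup>2 = (norm (T x))\<^sup>2"
proof -
  have "(norm (T x + D x))\<^sup>2 + (norm (T x - D x))\<^sup>2 = 2 * (norm (T x))\<^sup>2 + 2 * (norm (D x))\<^sup>2"
    unfolding power2_norm_eq_inner by (simp add: inner_simps inner_commute)
  then show ?thesis
    unfolding A_eq B_eq by (simp add: norm_scaleC norm_divide norm_mult norm_D power_divide)
qed

lemma norm_A_le: "norm (A x) \<le> norm (T x)" and norm_B_le: "norm (B x) \<le> norm (T x)"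
proof -
  have "(norm (A x))\<^sup>2 \<le> (norm (T x))\<^sup>2" "(norm (B x))\<^sup>2 \<le> (norm (T x))\<^sup>2"
    using norm_A_B[of x] zero_le_power2[of "norm (A x)"] zero_le_power2[of "norm (B x)"] by linarith+
  then show "norm (A x) \<le> norm (T x)" "norm (B x) \<le> norm (T x)" by simp_all
qed

lemma bounded_clinear_A_B: "bounded_clinear A" "bounded_clinear B"
proof -
  obtain K where K: "\<And>x. norm (T x) \<le> norm x * K"
    using bounded_linear.bounded[OF bounded_clinearD(1)[OF T(1)]] by blast
  then have le: "norm (A x) \<le> norm x * K" "norm (B x) \<le> norm x * K" for x
    using norm_A_le norm_B_le order_trans by blast+
  note TD = bounded_clinearD(2,3)[OF T(1)] bounded_clinearD(2,3)[OF D(1)]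
  show "bounded_clinear A"
    by (rule bounded_clinear_intro[OF _ _ le(1)])
      (simp_all add: A_eq TD scaleC_add_right scaleC_scaleC mult.commute)
  show "bounded_clinear B"
    by (rule bounded_clinear_intro[OF _ _ le(2)])
      (simp_all add: B_eq TD scaleC_add_right scaleC_scaleC mult.commute complex_vector.scale_right_diff_distrib)
qed

lemma seq_compact_A_B: "seq_compact_op A" "seq_compact_op B"
proof -
  have "norm (A x) \<le> 1 * norm (T x)" "norm (B x) \<le> 1 * norm (T x)" for x
    using norm_A_le norm_B_le by simp_all
  then show "seq_compact_op A" "seq_compact_op B"
    using seq_compact_op_dominated[OF T_compact T(1)] bounded_clinear_A_B by blast+
qed

lemma A'_A: "cadjoint A (A x) = (1/4) *\<^sub>R (2 *\<^sub>R T' (T x) + (T' (D x) + D' (T x)))"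
  and B'_B: "cadjoint B (B x) = (1/4) *\<^sub>R (2 *\<^sub>R T' (T x) - (T' (D x) + D' (T x)))"
proof -
  note lin = bounded_clinearD[OF T(2)] bounded_clinearD[OF D(2)]
  have "cadjoint A = (\<lambda>x. (1/2) *\<^sub>C (T' x + D' x))"
    by (rule cadjoint_eqI)
      (simp add: A_eq cinner_scaleC_left cinner_scaleC_right cinner_add_left cinner_add_right
        cinner_cadjoint(1)[OF T(1)] cinner_cadjoint(1)[OF D(1)] D(3))
  then show "cadjoint A (A x) = (1/4) *\<^sub>R (2 *\<^sub>R T' (T x) + (T' (D x) + D' (T x)))"
    unfolding scaleR_2
    by (simp add: A_eq lin D'_D scaleC_scaleC scaleC_add_right ac_simps flip: scaleC_of_real)
  have "cadjoint B = (\<lambda>x. (- 1 / (2 * \<i>)) *\<^sub>C (T' x - D' x))"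
    by (rule cadjoint_eqI)
      (simp add: B_eq cinner_scaleC_left cinner_scaleC_right cinner_diff_left cinner_diff_right
        cinner_minus_left cinner_minus_right cinner_cadjoint(1)[OF T(1)] cinner_cadjoint(1)[OF D(1)] D(3))
  then show "cadjoint B (B x) = (1/4) *\<^sub>R (2 *\<^sub>R T' (T x) - (T' (D x) + D' (T x)))"
    unfolding scaleR_2
    by (simp add: B_eq lin D'_D scaleC_scaleC scaleC_add_right complex_vector.scale_right_diff_distrib algebra_simps flip: scaleC_of_real)
qed

text \<open>
  Both operators are combinations of \<open>g = T\<^sup>* T\<close> and \<open>m = T\<^sup>* D + D\<^sup>* T\<close>, which commute by
  \<open>D\<^sup>* D = T\<^sup>* T\<close> and \<open>D D\<^sup>* = T T\<^sup>*\<close>.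
\<close>

lemma A'_A_commutes_B'_B: "(cadjoint A \<circ> A) \<circ> (cadjoint B \<circ> B) = (cadjoint B \<circ> B) \<circ> (cadjoint A \<circ> A)"
proof -
  define g where "g = T' \<circ> T"
  define m where "m x = T' (D x) + D' (T x)" for x
  note lin = bounded_clinearD[OF T(1)] bounded_clinearD[OF T(2)] bounded_clinearD[OF D(1)] bounded_clinearD[OF D(2)]
  have lin': "g (x + y) = g x + g y" "g (x - y) = g x - g y" "g (r *\<^sub>R x) = r *\<^sub>R g x"
    "m (x + y) = m x + m y" "m (x - y) = m x - m y" "m (r *\<^sub>R x) = r *\<^sub>R m x" for x y r
    unfolding g_def m_def by (simp_all add: lin algebra_simps)
  have "T' (D (T' (T x))) = T' (T (T' (D x)))" for x
    by (simp flip: D'_D D_D')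
  moreover have "D' (T (T' (T x))) = T' (T (D' (T x)))" for x
    using D_D'[of "T x"] D'_D[of "D' (T x)"] by simp
  ultimately have gm: "m (g x) = g (m x)" for x
    unfolding g_def m_def by (simp add: lin)
  have AA: "(cadjoint A \<circ> A) x = (1/4) *\<^sub>R (2 *\<^sub>R g x + m x)"
    and BB: "(cadjoint B \<circ> B) x = (1/4) *\<^sub>R (2 *\<^sub>R g x - m x)" for x
    unfolding g_def m_def by (simp_all add: A'_A B'_B)
  show ?thesis
    by (rule ext) (simp only: AA BB comp_apply[of "cadjoint A \<circ> A"] comp_apply[of "cadjoint B \<circ> B"],
      simp add: lin' gm algebra_simps)
qed

text \<open>
  Commutation passes to square roots, one factor at a time.
\<close>

lemma abs_A_commutes_abs_B: "abs_op A \<circ> abs_op B = abs_op B \<circ> abs_op A"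
proof -
  note GA = positive_cadjoint_comp_self[OF bounded_clinear_A_B(1)]
    seq_compact_cadjoint_comp_self[OF bounded_clinear_A_B(1) seq_compact_A_B(1)]
  note GB = positive_cadjoint_comp_self[OF bounded_clinear_A_B(2)]
    seq_compact_cadjoint_comp_self[OF bounded_clinear_A_B(2) seq_compact_A_B(2)]
  have "abs_op A \<circ> (cadjoint B \<circ> B) = (cadjoint B \<circ> B) \<circ> abs_op A"
    unfolding abs_op_def
    by (rule sqrt_op_commute[OF GA positive_opD(1)[OF GB(1)] A'_A_commutes_B'_B[symmetric]])
  then have "abs_op B \<circ> abs_op A = abs_op A \<circ> abs_op B"
    unfolding abs_op_def[of B]
    by (intro sqrt_op_commute[OF GB] positive_opD(1) abs_op(1) bounded_clinear_A_B seq_compact_A_B)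
  then show ?thesis by simp
qed

end

theorem theorem5p4:
  fixes C T A B :: "'a::complex_hilbert \<Rightarrow> 'a" and j :: nat
  assumes "separable_space (euclidean :: 'a topology)"
    and "conjugation C"
    and "compact_op T"
    and "C_normal C T"
    and "A = cartesian_A C T"
    and "B = cartesian_B C T"
    and "j \<ge> 1"
  shows "1 / sqrt 2 * singular_value (\<lambda>x. abs_op A x + abs_op B x) j \<le> singular_value T j
    \<and> singular_value T j \<le> singular_value (\<lambda>x. abs_op A x + abs_op B x) j"
proof -
  interpret C_normal_compact C T
    using assms by unfold_locales (simp_all add: compact_op_imp_seq_compact_op)
  define P where "P = abs_op A"
  define Q where "Q = abs_op B"
  define S where "S = (\<lambda>x. P x + Q x)"
  have P: "positive_op P" "seq_compact_op P" "norm (P x) = norm (A x)" for x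
    unfolding P_def assms(5) using abs_op[OF bounded_clinear_A_B(1) seq_compact_A_B(1)] by auto
  have Q: "positive_op Q" "norm (Q x) = norm (B x)" for x
    unfolding Q_def assms(6) using abs_op[OF bounded_clinear_A_B(2) seq_compact_A_B(2)] by auto
  have "P \<circ> Q = Q \<circ> P"
    unfolding P_def Q_def assms(5,6) by (rule abs_A_commutes_abs_B)
  then have inner_nonneg: "0 \<le> inner (P x) (Q x)" for x by (rule inner_commuting_positive[OF P(1,2) Q(1)])
  have T_eq: "(norm (T x))\<^sup>2 = (norm (P x))\<^sup>2 + (norm (Q x))\<^sup>2" for x
    using norm_A_B[of x] by (simp add: P(3) Q(2) assms(5,6))
  have S_eq: "(norm (S x))\<^sup>2 = (norm (T x))\<^sup>2 + 2 * inner (P x) (Q x)" for x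
    unfolding T_eq S_def unfolding power2_norm_eq_inner by (simp add: inner_simps inner_commute)
  have lower: "norm (T x) \<le> 1 * norm (S x)" for x
    by (rule power2_le_imp_le) (use S_eq[of x] inner_nonneg[of x] in simp_all)
  have upper: "norm (S x) \<le> sqrt 2 * norm (T x)" for x
  proof (rule power2_le_imp_le)
    have "0 \<le> (norm (P x - Q x))\<^sup>2" by simp
    also have "\<dots> = (norm (T x))\<^sup>2 - 2 * inner (P x) (Q x)"
      unfolding T_eq unfolding power2_norm_eq_inner by (simp add: inner_simps inner_commute)
    finally show "(norm (S x))\<^sup>2 \<le> (sqrt 2 * norm (T x))\<^sup>2"
      by (simp add: S_eq power_mult_distrib)
  qed simp
  have S_clin: "bounded_clinear S"
    using positive_opD(1)[OF P(1)] positive_opD(1)[OF Q(1)]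
    unfolding S_def bounded_clinear_def by (simp add: bounded_linear_add scaleC_add_right)
  have S_compact: "seq_compact_op S" by (rule seq_compact_op_dominated[OF T_compact T(1) S_clin upper])
  have "singular_value S j \<le> sqrt 2 * singular_value T j"
    by (rule singular_value_mono[OF S_clin S_compact T(1) T_compact upper]) simp
  moreover have "singular_value T j \<le> 1 * singular_value S j"
    by (rule singular_value_mono[OF T(1) T_compact S_clin S_compact lower]) simp
  ultimately show ?thesis
    unfolding S_def P_def Q_def by (simp add: field_simps)
qed

end
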